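(* Let $I\subset\mathbb{R}$ be an interval, let $\Omega\subset I\times I$ be a serrated domain, and let $X=\{X_t:t\in I\}$ be a Gaussian process with covariance $K$. Then $X$ forms an undirected graphical model with respect to $\Omega$ if and only if $K\in\mathscr{G}_\Omega$, where $$\mathscr{G}_\Omega=\Big\{K\in\mathscr{C}:\ K(s,t)=\big\langle K(s,\cdot),K(\cdot,t)\big\rangle_{\mathscr{H}(K_J)}\ \text{for all } J\subset I \text{ separating } s,t\in I \text{ in } \Omega\Big\}.$$
   Context: $\mathscr{C}$ is the set of covariances on $I$, i.e. symmetric functions $K:I\times I\to\mathbb{R}$ with $\sum_{i,j=1}^n\alpha_i\alpha_jK(t_i,t_j)\ge 0$ for all $n\ge1$, $t_i\in I$, $\alpha_i\in\mathbb{R}$. A serrated domain is $\Omega=\bigcup_{j=1}^m (I_j\times I_j)$ with $\{I_j\}_{j=1}^m$ a finite collection of subintervals covering $I$. For $J\subset I$, $K_J=K|_{J\times J}$ and $\mathscr{H}(K_J)$ is its reproducing kernel Hilbert space ($\mathscr{H}(K_\emptyset)=\{0\}$); functions inside its inner product are restricted to $J$. A set $J\subset I$ separates $s,t\in I$ in $\Omega$ (i.e. in the graph with vertex set $I$ and edge set $\Omega$) if for every finite sequence $t_1=s,t_2,\dots,t_r=t$ in $I$ ($r\ge1$) with $(t_i,t_{i+1})\in\Omega$ for $1\le i<r$, there is $1<j<r$ with $t_j\in J$. A Gaussian process $X=\{X_t:t\in I\}$ forms an undirected graphical model over $\Omega$ if for every $s,t\in I$ separated by $J\subset I$, with $X_J=\{X_u:u\in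 J\}$, $$\mathbb{E}\big[(X_s-\mathbb{E}[X_s|X_J])(X_t-\mathbb{E}[X_t|X_J])\,\big|\,X_J\big]=0\quad\text{a.s.}$$ *)

theory Defs
  imports "HOL-Probability.Probability"
begin

section \<open>Covariances\<close>

text \<open>A function on \<open>I \<times> I\<close> is represented by a total function of which only the values on
  \<open>I \<times> I\<close> are ever used.\<close>

definition covariances :: "real set \<Rightarrow> (real \<Rightarrow> real \<Rightarrow> real) set" where
  "covariances I = {K.
     (\<forall>s\<in>I. \<forall>t\<in>I. K s t = K t s) \<and>
     (\<forall>n\<ge>1. \<forall>t :: nat \<Rightarrow> real. \<forall>\<alpha> :: nat \<Rightarrow> real. (\<forall>i\<in>{1..n}. t i \<in> I) \<longrightarrow>
        (\<Sum>i=1..n. \<Sum>j=1..n. \<alpha> i * \<alpha> j * K (t i) (t j)) \<ge> 0)}"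


section \<open>Reproducing kernel Hilbert spaces\<close>

text \<open>A function on \<open>J\<close> is represented by the total function extending it by \<open>0\<close>, so that pointwise
  operations make these functions a vector space and equality is equality on \<open>J\<close>.\<close>

definition restr :: "real set \<Rightarrow> (real \<Rightarrow> real) \<Rightarrow> real \<Rightarrow> real" where
  "restr J f = (\<lambda>x. if x \<in> J then f x else 0)"

text \<open>\<open>is_rkhs J K H ip\<close>: the functions in \<open>H\<close> form, with inner product \<open>ip\<close>, a real Hilbert space
  of functions on \<open>J\<close> with reproducing kernel \<open>K\<close> restricted to \<open>J \<times> J\<close>. The first clause about
  \<open>ip\<close> fixes its irrelevant values outside \<open>H\<close>, so that at most one pair \<open>(H, ip)\<close> qualifies; by
  Moore--Aronszajn exactly one does when \<open>K\<close> is a covariance on \<open>J\<close>.\<close>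

definition is_rkhs :: "real set \<Rightarrow> (real \<Rightarrow> real \<Rightarrow> real) \<Rightarrow>
    (real \<Rightarrow> real) set \<Rightarrow> ((real \<Rightarrow> real) \<Rightarrow> (real \<Rightarrow> real) \<Rightarrow> real) \<Rightarrow> bool" where
  "is_rkhs J K H ip \<longleftrightarrow>
     (\<forall>f\<in>H. restr J f = f) \<and>
     (\<lambda>x. 0) \<in> H \<and>
     (\<forall>f\<in>H. \<forall>g\<in>H. (\<lambda>x. f x + g x) \<in> H) \<and>
     (\<forall>c. \<forall>f\<in>H. (\<lambda>x. c * f x) \<in> H) \<and>
     (\<forall>f g. f \<notin> H \<or> g \<notin> H \<longrightarrow> ip f g = 0) \<and>
     (\<forall>f\<in>H. \<forall>g\<in>H. ip f g = ip g f) \<and>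
     (\<forall>f\<in>H. \<forall>g\<in>H. \<forall>h\<in>H. ip (\<lambda>x. f x + g x) h = ip f h + ip g h) \<and>
     (\<forall>c. \<forall>f\<in>H. \<forall>g\<in>H. ip (\<lambda>x. c * f x) g = c * ip f g) \<and>
     (\<forall>f\<in>H. f \<noteq> (\<lambda>x. 0) \<longrightarrow> ip f f > 0) \<and>
     (\<forall>f :: nat \<Rightarrow> real \<Rightarrow> real. (\<forall>n. f n \<in> H) \<longrightarrow>
        (\<forall>e>0. \<exists>N. \<forall>m\<ge>N. \<forall>n\<ge>N.
           sqrt (ip (\<lambda>x. f m x - f n x) (\<lambda>x. f m x - f n x)) < e) \<longrightarrow>
        (\<exists>g\<in>H. (\<lambda>n. sqrt (ip (\<lambda>x. f n x - g x) (\<lambda>x. f n x - g x))) \<longlonglongrightarrow> 0)) \<and>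
     (\<forall>u\<in>J. restr J (\<lambda>v. K v u) \<in> H) \<and>
     (\<forall>u\<in>J. \<forall>f\<in>H. ip f (restr J (\<lambda>v. K v u)) = f u)"

definition rkhs_inner :: "(real \<Rightarrow> real \<Rightarrow> real) \<Rightarrow> real set \<Rightarrow>
    (real \<Rightarrow> real) \<Rightarrow> (real \<Rightarrow> real) \<Rightarrow> real" where
  "rkhs_inner K J f g =
     (let (H, ip) = (THE (H, ip). is_rkhs J K H ip) in ip (restr J f) (restr J g))"


section \<open>Serrated domains and separation\<close>

definition serrated_domain :: "real set \<Rightarrow> (real \<times> real) set \<Rightarrow> bool" where
  "serrated_domain I \<Omega> \<longleftrightarrow>
     (\<exists>\<J>. finite \<J> \<and> (\<forall>A\<in>\<J>. is_interval A \<and> A \<subseteq> I) \<and> \<Union>\<J> = I \<and> \<Omega> = (\<Union>A\<in>\<J>. A \<times> A))"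

text \<open>The separating vertex must be an interior vertex of the path; in particular nothing separates
  \<open>s\<close> from itself, because of the path with \<open>r = 1\<close>.\<close>

definition separates :: "real set \<Rightarrow> (real \<times> real) set \<Rightarrow> real set \<Rightarrow> real \<Rightarrow> real \<Rightarrow> bool" where
  "separates I \<Omega> J s t \<longleftrightarrow>
     (\<forall>r\<ge>1. \<forall>p :: nat \<Rightarrow> real.
        p 1 = s \<and> p r = t \<and> (\<forall>i\<in>{1..r}. p i \<in> I) \<and>
        (\<forall>i. 1 \<le> i \<and> i < r \<longrightarrow> (p i, p (i + 1)) \<in> \<Omega>) \<longrightarrow>
        (\<exists>j. 1 < j \<and> j < r \<and> p j \<in> J))"

definition graphical_covariances :: "real set \<Rightarrow> (real \<times> real) set \<Rightarrow> (real \<Rightarrow> real \<Rightarrow> real) set" where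
  "graphical_covariances I \<Omega> = {K \<in> covariances I.
     \<forall>J\<subseteq>I. \<forall>s\<in>I. \<forall>t\<in>I. separates I \<Omega> J s t \<longrightarrow>
       K s t = rkhs_inner K J (\<lambda>u. K s u) (\<lambda>u. K u t)}"


section \<open>Gaussian processes\<close>

text \<open>Constants count as (degenerate) Gaussian random variables.\<close>

definition gaussian_rv :: "'a measure \<Rightarrow> ('a \<Rightarrow> real) \<Rightarrow> bool" where
  "gaussian_rv M Y \<longleftrightarrow> Y \<in> borel_measurable M \<and>
     ((\<exists>\<mu> \<sigma>. \<sigma> > 0 \<and> distributed M lborel Y (normal_density \<mu> \<sigma>)) \<or>
      (\<exists>\<mu>. AE \<omega> in M. Y \<omega> = \<mu>))"

definition gaussian_process :: "'a measure \<Rightarrow> real set \<Rightarrow> (real \<Rightarrow> 'a \<Rightarrow> real) \<Rightarrow> bool" where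
  "gaussian_process M I X \<longleftrightarrow>
     (\<forall>F c. finite F \<and> F \<subseteq> I \<longrightarrow> gaussian_rv M (\<lambda>\<omega>. \<Sum>u\<in>F. c u * X u \<omega>))"

definition has_covariance ::
    "'a measure \<Rightarrow> real set \<Rightarrow> (real \<Rightarrow> 'a \<Rightarrow> real) \<Rightarrow> (real \<Rightarrow> real \<Rightarrow> real) \<Rightarrow> bool" where
  "has_covariance M I X K \<longleftrightarrow>
     (\<forall>s\<in>I. \<forall>t\<in>I. K s t =
        (\<integral>\<omega>. (X s \<omega> - (\<integral>\<omega>'. X s \<omega>' \<partial>M)) * (X t \<omega> - (\<integral>\<omega>'. X t \<omega>' \<partial>M)) \<partial>M))"

text \<open>The sigma-algebra on the sample space generated by \<open>X\<^sub>J = {X\<^sub>u : u \<in> J}\<close>, that is, by \<open>X\<^sub>J\<close> as a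
  map into the product space.\<close>

definition sigma_of :: "'a measure \<Rightarrow> (real \<Rightarrow> 'a \<Rightarrow> real) \<Rightarrow> real set \<Rightarrow> 'a measure" where
  "sigma_of M X J =
     vimage_algebra (space M) (\<lambda>\<omega>. \<lambda>u\<in>J. X u \<omega>) (\<Pi>\<^sub>M u\<in>J. (borel :: real measure))"

definition cond_expect ::
    "'a measure \<Rightarrow> (real \<Rightarrow> 'a \<Rightarrow> real) \<Rightarrow> real set \<Rightarrow> ('a \<Rightarrow> real) \<Rightarrow> 'a \<Rightarrow> real" where
  "cond_expect M X J Y = real_cond_exp M (sigma_of M X J) Y"

definition undirected_graphical_model ::
    "'a measure \<Rightarrow> real set \<Rightarrow> (real \<Rightarrow> 'a \<Rightarrow> real) \<Rightarrow> (real \<times> real) set \<Rightarrow> bool" where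
  "undirected_graphical_model M I X \<Omega> \<longleftrightarrow>
     (\<forall>J\<subseteq>I. \<forall>s\<in>I. \<forall>t\<in>I. separates I \<Omega> J s t \<longrightarrow>
        (AE \<omega> in M. cond_expect M X J
           (\<lambda>\<omega>'. (X s \<omega>' - cond_expect M X J (X s) \<omega>') * (X t \<omega>' - cond_expect M X J (X t) \<omega>')) \<omega> = 0))"

end

theory Submission
  imports Defs
begin

text \<open>Both sides of the theorem quantify over the same triples \<open>J\<close>, \<open>s\<close>, \<open>t\<close>, so it suffices to
  compare the two conditions for one triple at a time (\<open>conditionally_uncorrelated_iff\<close>). Write
  \<open>D\<^sub>u = X\<^sub>u - E[X\<^sub>u]\<close> for the centred variables, let \<open>L\<^sub>J\<close> be the closed linear span in \<open>L\<^sup>2\<close> of the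
  \<open>D\<^sub>u\<close> with \<open>u \<in> J\<close>, and let \<open>P\<close>, \<open>Q\<close> be the orthogonal projections of \<open>D\<^sub>s\<close>, \<open>D\<^sub>t\<close> onto \<open>L\<^sub>J\<close>. Both
  conditions turn out to say that the residuals \<open>R = D\<^sub>s - P\<close> and \<open>R' = D\<^sub>t - Q\<close> are orthogonal.

  On the side of the kernel, \<open>u \<mapsto> \<langle>D\<^sub>u, Y\<rangle>\<close> is an isometry of \<open>L\<^sub>J\<close> onto the reproducing kernel
  Hilbert space of \<open>K\<close> on \<open>J\<close>, and it maps \<open>P\<close> and \<open>Q\<close> to the restrictions of
  \<open>K(s,\<cdot>)\<close> and \<open>K(\<cdot>,t)\<close> to \<open>J\<close> (\<open>rkhs_inner_feature_map\<close>). Hence the inner product in the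
  theorem is \<open>\<langle>P, Q\<rangle>\<close>, and
  \<open>\<langle>R, R'\<rangle> = \<langle>D\<^sub>s, D\<^sub>t\<rangle> - \<langle>P, Q\<rangle>\<close> is the difference of the two sides of the kernel identity.

  On the side of the process, every element \<open>V\<close> of the Gaussian space \<open>L\<^sub>I\<close> satisfies
  \<open>E[exp(\<i>V)] = exp(-\<parallel>V\<parallel>\<^sup>2/2)\<close>, because this holds for finite linear combinations and survives
  limits in \<open>L\<^sup>2\<close>. So a \<open>V\<close> orthogonal to \<open>L\<^sub>J\<close> has \<open>E[exp(\<i>(V + W))] = E[exp(\<i>V)] E[exp(\<i>W)]\<close>
  for all \<open>W\<close> in the span of the \<open>D\<^sub>u\<close> with \<open>u \<in> J\<close>, and uniqueness of Fourier transforms makes \<open>V\<close>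
  independent of the sigma-algebra generated by \<open>X\<^sub>J\<close> (\<open>orthogonal_imp_independent\<close>). Consequently
  \<open>E[X\<^sub>s | X\<^sub>J] = E[X\<^sub>s] + P\<close> (\<open>cond_expect_eq_projection\<close>), and the conditional expectation of \<open>R R'\<close>
  given \<open>X\<^sub>J\<close> is the constant \<open>\<langle>R, R'\<rangle>\<close> (\<open>cond_expect_residual_product\<close>); it vanishes almost surely
  exactly when \<open>R\<close> and \<open>R'\<close> are orthogonal.\<close>

section \<open>Hilbert spaces of functions with a semi-inner product\<close>

lemma nonneg_quadratic_discriminant:
  fixes a b c :: real
  assumes nonneg: "\<And>t. 0 \<le> a + 2 * t * b + t\<^sup>2 * c" and c: "0 \<le> c"
  shows "b\<^sup>2 \<le> a * c"
proof (cases "c = 0")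
  case True
  have "b = 0"
  proof (rule ccontr)
    assume "b \<noteq> 0"
    then show False using nonneg[of "- (a + 1) / (2 * b)"] True by (simp add: field_simps)
  qed
  then show ?thesis using True by simp
next
  case False
  then have "0 < c" using c by simp
  then show ?thesis
    using nonneg[of "- b / c"] by (simp add: field_simps power2_eq_square)
qed

definition lin_span :: "('i \<Rightarrow> 'a \<Rightarrow> real) \<Rightarrow> 'i set \<Rightarrow> ('a \<Rightarrow> real) set" where
  "lin_span \<phi> J = {\<lambda>x. \<Sum>u\<in>F. c u * \<phi> u x | F c. finite F \<and> F \<subseteq> J}"

lemma lin_spanI: "finite F \<Longrightarrow> F \<subseteq> J \<Longrightarrow> (\<lambda>x. \<Sum>u\<in>F. c u * \<phi> u x) \<in> lin_span \<phi> J"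
  unfolding lin_span_def by blast

lemma lin_spanE:
  assumes "f \<in> lin_span \<phi> J"
  obtains F c where "finite F" "F \<subseteq> J" "f = (\<lambda>x. \<Sum>u\<in>F. c u * \<phi> u x)"
  using assms unfolding lin_span_def by blast

lemma lin_span_zero: "(\<lambda>x. 0) \<in> lin_span \<phi> J"
  using lin_spanI[of "{}"] by simp

lemma lin_span_base: "u \<in> J \<Longrightarrow> \<phi> u \<in> lin_span \<phi> J"
  using lin_spanI[of "{u}" J "\<lambda>_. 1" \<phi>] by simp

lemma lin_span_mono: "J \<subseteq> I \<Longrightarrow> lin_span \<phi> J \<subseteq> lin_span \<phi> I"
  unfolding lin_span_def by blast

lemma lin_span_scale:
  assumes "f \<in> lin_span \<phi> J"
  shows "(\<lambda>x. a * f x) \<in> lin_span \<phi> J"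
proof -
  obtain F c where F: "finite F" "F \<subseteq> J" "f = (\<lambda>x. \<Sum>u\<in>F. c u * \<phi> u x)"
    using lin_spanE[OF assms] by metis
  have "(\<lambda>x. a * f x) = (\<lambda>x. \<Sum>u\<in>F. (a * c u) * \<phi> u x)"
    by (simp add: F(3) sum_distrib_left mult.assoc)
  then show ?thesis using lin_spanI[OF F(1,2)] by metis
qed

lemma lin_span_add:
  assumes "f \<in> lin_span \<phi> J" "g \<in> lin_span \<phi> J"
  shows "(\<lambda>x. f x + g x) \<in> lin_span \<phi> J"
proof -
  obtain F c where F: "finite F" "F \<subseteq> J" "f = (\<lambda>x. \<Sum>u\<in>F. c u * \<phi> u x)"
    using lin_spanE[OF assms(1)] by metis
  obtain G d where G: "finite G" "G \<subseteq> J" "g = (\<lambda>x. \<Sum>u\<in>G. d u * \<phi> u x)"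
    using lin_spanE[OF assms(2)] by metis
  define e where "e u = (if u \<in> F then c u else 0) + (if u \<in> G then d u else 0)" for u
  have "f x + g x = (\<Sum>u\<in>F \<union> G. e u * \<phi> u x)" for x
  proof -
    have "f x = (\<Sum>u\<in>F \<union> G. (if u \<in> F then c u else 0) * \<phi> u x)"
      unfolding F(3) by (rule sum.mono_neutral_cong_left) (use F G in auto)
    moreover have "g x = (\<Sum>u\<in>F \<union> G. (if u \<in> G then d u else 0) * \<phi> u x)"
      unfolding G(3) by (rule sum.mono_neutral_cong_left) (use F G in auto)
    ultimately show ?thesis by (simp add: e_def distrib_right sum.distrib)
  qed
  then have "(\<lambda>x. f x + g x) = (\<lambda>x. \<Sum>u\<in>F \<union> G. e u * \<phi> u x)" by blast
  then show ?thesis using lin_spanI[of "F \<union> G" J e \<phi>] F G by simp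
qed

text \<open>The form \<open>ip\<close> may be degenerate. This makes square-integrable random variables an instance without
  passing to classes modulo equality almost everywhere, while the reproducing kernel Hilbert spaces
  are the instances with a definite form. The completeness clause has the shape used in the
  definition of the latter.\<close>
locale semi_hilbert =
  fixes V :: "('a \<Rightarrow> real) set" and ip :: "('a \<Rightarrow> real) \<Rightarrow> ('a \<Rightarrow> real) \<Rightarrow> real"
  assumes zero_mem [simp]: "(\<lambda>x. 0) \<in> V"
    and add_mem [simp]: "\<lbrakk>f \<in> V; g \<in> V\<rbrakk> \<Longrightarrow> (\<lambda>x. f x + g x) \<in> V"
    and scale_mem [simp]: "f \<in> V \<Longrightarrow> (\<lambda>x. c * f x) \<in> V"
    and ip_commute: "\<lbrakk>f \<in> V; g \<in> V\<rbrakk> \<Longrightarrow> ip f g = ip g f"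
    and ip_add_left: "\<lbrakk>f \<in> V; g \<in> V; h \<in> V\<rbrakk> \<Longrightarrow> ip (\<lambda>x. f x + g x) h = ip f h + ip g h"
    and ip_scale_left: "\<lbrakk>f \<in> V; g \<in> V\<rbrakk> \<Longrightarrow> ip (\<lambda>x. c * f x) g = c * ip f g"
    and ip_nonneg: "f \<in> V \<Longrightarrow> 0 \<le> ip f f"
    and complete: "\<lbrakk>\<And>n. F n \<in> V;
        \<forall>e>0. \<exists>N. \<forall>m\<ge>N. \<forall>n\<ge>N.
          sqrt (ip (\<lambda>x. F m x - F n x) (\<lambda>x. F m x - F n x)) < e\<rbrakk> \<Longrightarrow>
        \<exists>g\<in>V. (\<lambda>n::nat. sqrt (ip (\<lambda>x. F n x - g x) (\<lambda>x. F n x - g x))) \<longlonglongrightarrow> 0"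
begin

definition nrm :: "('a \<Rightarrow> real) \<Rightarrow> real" where "nrm f = sqrt (ip f f)"

lemma diff_mem [simp]: "\<lbrakk>f \<in> V; g \<in> V\<rbrakk> \<Longrightarrow> (\<lambda>x. f x - g x) \<in> V"
  using add_mem[of f "\<lambda>x. (-1) * g x"] scale_mem[of g "-1"] by simp

lemma ip_diff_left: "\<lbrakk>f \<in> V; g \<in> V; h \<in> V\<rbrakk> \<Longrightarrow> ip (\<lambda>x. f x - g x) h = ip f h - ip g h"
  using ip_add_left[of f "\<lambda>x. (-1) * g x" h] scale_mem[of g "-1"] ip_scale_left[of g h "-1"]
  by simp

lemma ip_add_right: "\<lbrakk>f \<in> V; g \<in> V; h \<in> V\<rbrakk> \<Longrightarrow> ip h (\<lambda>x. f x + g x) = ip h f + ip h g"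
  by (simp add: ip_commute[of h] ip_add_left)

lemma ip_diff_right: "\<lbrakk>f \<in> V; g \<in> V; h \<in> V\<rbrakk> \<Longrightarrow> ip h (\<lambda>x. f x - g x) = ip h f - ip h g"
  by (simp add: ip_commute[of h] ip_diff_left)

lemma ip_scale_right: "\<lbrakk>f \<in> V; g \<in> V\<rbrakk> \<Longrightarrow> ip g (\<lambda>x. c * f x) = c * ip g f"
  by (simp add: ip_commute[of g] ip_scale_left)

lemmas ip_bilinear = ip_add_left ip_add_right ip_diff_left ip_diff_right ip_scale_left ip_scale_right

lemma ip_zero_left: "f \<in> V \<Longrightarrow> ip (\<lambda>x. 0) f = 0"
  using ip_scale_left[of f f 0] by simp

lemma sum_mem_ip_sum_left:
  assumes "finite F" "\<And>u. u \<in> F \<Longrightarrow> \<phi> u \<in> V"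
  shows "(\<lambda>x. \<Sum>u\<in>F. c u * \<phi> u x) \<in> V \<and>
    (\<forall>g\<in>V. ip (\<lambda>x. \<Sum>u\<in>F. c u * \<phi> u x) g = (\<Sum>u\<in>F. c u * ip (\<phi> u) g))"
  using assms
proof (induction F)
  case empty
  then show ?case by (simp add: ip_zero_left)
next
  case (insert v F)
  then show ?case by (simp add: ip_bilinear)
qed

lemma ip_lin_comb:
  assumes "finite F" "F \<subseteq> J" "w = (\<lambda>x. \<Sum>u\<in>F. c u * \<phi> u x)"
    and "\<And>u. u \<in> J \<Longrightarrow> \<phi> u \<in> V" "g \<in> V"
  shows "ip w g = (\<Sum>u\<in>F. c u * ip (\<phi> u) g)"
  using sum_mem_ip_sum_left[of F \<phi> c] assms by blast

lemma lin_span_mem: "\<lbrakk>\<And>u. u \<in> J \<Longrightarrow> \<phi> u \<in> V; f \<in> lin_span \<phi> J\<rbrakk> \<Longrightarrow> f \<in> V"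
  by (erule lin_spanE) (use sum_mem_ip_sum_left in blast)

lemma nrm_nonneg: "f \<in> V \<Longrightarrow> 0 \<le> nrm f"
  by (simp add: nrm_def ip_nonneg)

lemma nrm_square: "f \<in> V \<Longrightarrow> (nrm f)\<^sup>2 = ip f f"
  by (simp add: nrm_def ip_nonneg)

lemma Cauchy_Schwarz:
  assumes "f \<in> V" "g \<in> V"
  shows "\<bar>ip f g\<bar> \<le> nrm f * nrm g"
proof -
  have "(ip f g)\<^sup>2 \<le> ip f f * ip g g"
  proof (rule nonneg_quadratic_discriminant)
    fix t
    have "0 \<le> ip (\<lambda>x. f x + t * g x) (\<lambda>x. f x + t * g x)"
      using assms by (intro ip_nonneg) simp
    also have "\<dots> = ip f f + 2 * t * ip f g + t\<^sup>2 * ip g g"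
      using assms by (simp add: ip_bilinear ip_commute[of g f] algebra_simps power2_eq_square)
    finally show "0 \<le> ip f f + 2 * t * ip f g + t\<^sup>2 * ip g g" .
  qed (use assms ip_nonneg in auto)
  then have "sqrt ((ip f g)\<^sup>2) \<le> sqrt (ip f f * ip g g)" by (rule real_sqrt_le_mono)
  then show ?thesis by (simp add: nrm_def real_sqrt_mult)
qed

lemma nrm_triangle:
  assumes "f \<in> V" "g \<in> V"
  shows "nrm (\<lambda>x. f x + g x) \<le> nrm f + nrm g"
proof (rule power2_le_imp_le)
  have "(nrm (\<lambda>x. f x + g x))\<^sup>2 = (nrm f)\<^sup>2 + 2 * ip f g + (nrm g)\<^sup>2"
    using assms by (simp add: nrm_square ip_bilinear ip_commute[of g f])
  also have "\<dots> \<le> (nrm f + nrm g)\<^sup>2"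
    using Cauchy_Schwarz[OF assms] by (simp add: power2_sum)
  finally show "(nrm (\<lambda>x. f x + g x))\<^sup>2 \<le> (nrm f + nrm g)\<^sup>2" .
qed (use assms nrm_nonneg in auto)

lemma nrm_diff_commute:
  assumes "f \<in> V" "g \<in> V"
  shows "nrm (\<lambda>x. f x - g x) = nrm (\<lambda>x. g x - f x)"
  using assms by (simp add: nrm_def ip_bilinear ip_commute[of g f])

lemma nrm_diff_triangle:
  assumes "f \<in> V" "g \<in> V" "h \<in> V"
  shows "nrm (\<lambda>x. f x - h x) \<le> nrm (\<lambda>x. f x - g x) + nrm (\<lambda>x. g x - h x)"
  using nrm_triangle[of "\<lambda>x. f x - g x" "\<lambda>x. g x - h x"] assms by simp

lemma nrm_diff_ge:
  assumes "f \<in> V" "g \<in> V"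
  shows "\<bar>nrm f - nrm g\<bar> \<le> nrm (\<lambda>x. f x - g x)"
  using nrm_diff_triangle[of f g "\<lambda>x. 0"] nrm_diff_triangle[of g f "\<lambda>x. 0"]
    nrm_diff_commute[of f g] assms by simp

lemma ip_eq_of_nrm_diff_zero:
  assumes "f \<in> V" "g \<in> V" "h \<in> V" "nrm (\<lambda>x. f x - g x) = 0"
  shows "ip f h = ip g h"
  using Cauchy_Schwarz[of "\<lambda>x. f x - g x" h] assms by (simp add: ip_bilinear)

lemma complete_nrm:
  assumes "\<And>n. F n \<in> V" "\<And>e. 0 < e \<Longrightarrow> \<exists>N. \<forall>m\<ge>N. \<forall>n\<ge>N. nrm (\<lambda>x. F m x - F n x) < e"
  obtains g where "g \<in> V" "(\<lambda>n::nat. nrm (\<lambda>x. F n x - g x)) \<longlonglongrightarrow> 0"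
  using complete[of F] assms unfolding nrm_def by blast

lemma ip_tendsto:
  assumes "\<And>n. F n \<in> V" "g \<in> V" "(\<lambda>n::nat. nrm (\<lambda>x. F n x - g x)) \<longlonglongrightarrow> 0" "h \<in> V"
  shows "(\<lambda>n. ip (F n) h) \<longlonglongrightarrow> ip g h"
proof -
  have "(\<lambda>n. ip (F n) h - ip g h) \<longlonglongrightarrow> 0"
  proof (rule Lim_null_comparison)
    show "\<forall>\<^sub>F n in sequentially. norm (ip (F n) h - ip g h) \<le> nrm (\<lambda>x. F n x - g x) * nrm h"
      using Cauchy_Schwarz[of "\<lambda>x. F _ x - g x" h] assms by (simp add: ip_bilinear)
    show "(\<lambda>n. nrm (\<lambda>x. F n x - g x) * nrm h) \<longlonglongrightarrow> 0"
      using tendsto_mult_left_zero[OF assms(3)] by simp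
  qed
  then show ?thesis by (simp add: LIM_zero_iff)
qed

lemma nrm_tendsto:
  assumes "\<And>n. F n \<in> V" "g \<in> V" "(\<lambda>n::nat. nrm (\<lambda>x. F n x - g x)) \<longlonglongrightarrow> 0"
  shows "(\<lambda>n. nrm (F n)) \<longlonglongrightarrow> nrm g"
proof -
  have "(\<lambda>n. nrm (F n) - nrm g) \<longlonglongrightarrow> 0"
    by (rule Lim_null_comparison[OF _ assms(3)]) (use nrm_diff_ge assms in auto)
  then show ?thesis by (simp add: LIM_zero_iff)
qed

definition clos :: "('a \<Rightarrow> real) set \<Rightarrow> ('a \<Rightarrow> real) set" where
  "clos W = {f \<in> V. \<exists>w. (\<forall>n. w n \<in> W) \<and> (\<lambda>n::nat. nrm (\<lambda>x. w n x - f x)) \<longlonglongrightarrow> 0}"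

lemma clos_mem: "f \<in> clos W \<Longrightarrow> f \<in> V"
  by (simp add: clos_def)

lemma clos_base: "W \<subseteq> V \<Longrightarrow> f \<in> W \<Longrightarrow> f \<in> clos W"
  unfolding clos_def by (auto simp: nrm_def ip_zero_left intro!: exI[of _ "\<lambda>_. f"])

lemma clos_mono: "W \<subseteq> U \<Longrightarrow> clos W \<subseteq> clos U"
  unfolding clos_def by blast

lemma clos_add:
  assumes W: "W \<subseteq> V" "\<And>f g. f \<in> W \<Longrightarrow> g \<in> W \<Longrightarrow> (\<lambda>x. f x + g x) \<in> W"
    and f: "f \<in> clos W" and g: "g \<in> clos W"
  shows "(\<lambda>x. f x + g x) \<in> clos W"
proof -
  obtain v where v: "\<And>n. v n \<in> W" "(\<lambda>n::nat. nrm (\<lambda>x. v n x - f x)) \<longlonglongrightarrow> 0"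
    using f unfolding clos_def by blast
  obtain w where w: "\<And>n. w n \<in> W" "(\<lambda>n::nat. nrm (\<lambda>x. w n x - g x)) \<longlonglongrightarrow> 0"
    using g unfolding clos_def by blast
  have mem: "v n \<in> V" "w n \<in> V" "f \<in> V" "g \<in> V" for n
    using v w f g W(1) clos_mem by auto
  have "(\<lambda>n. nrm (\<lambda>x. (v n x + w n x) - (f x + g x))) \<longlonglongrightarrow> 0"
  proof (rule Lim_null_comparison)
    have "norm (nrm (\<lambda>x. (v n x + w n x) - (f x + g x))) \<le> nrm (\<lambda>x. v n x - f x) + nrm (\<lambda>x. w n x - g x)" for n
      using nrm_triangle[of "\<lambda>x. v n x - f x" "\<lambda>x. w n x - g x"] mem
      by (simp add: nrm_nonneg algebra_simps)
    then show "\<forall>\<^sub>F n in sequentially. norm (nrm (\<lambda>x. (v n x + w n x) - (f x + g x)))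
        \<le> nrm (\<lambda>x. v n x - f x) + nrm (\<lambda>x. w n x - g x)" by simp
    show "(\<lambda>n. nrm (\<lambda>x. v n x - f x) + nrm (\<lambda>x. w n x - g x)) \<longlonglongrightarrow> 0"
      using tendsto_add[OF v(2) w(2)] by simp
  qed
  then show ?thesis unfolding clos_def using v(1) w(1) W(2) mem
    by (auto intro!: exI[of _ "\<lambda>n x. v n x + w n x"])
qed

lemma nrm_scale: "f \<in> V \<Longrightarrow> nrm (\<lambda>x. c * f x) = \<bar>c\<bar> * nrm f"
  by (simp add: nrm_def ip_bilinear real_sqrt_mult mult.assoc[symmetric])

lemma clos_scale:
  assumes W: "W \<subseteq> V" "\<And>c f. f \<in> W \<Longrightarrow> (\<lambda>x. c * f x) \<in> W"
    and f: "f \<in> clos W"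
  shows "(\<lambda>x. c * f x) \<in> clos W"
proof -
  obtain v where v: "\<And>n. v n \<in> W" "(\<lambda>n::nat. nrm (\<lambda>x. v n x - f x)) \<longlonglongrightarrow> 0"
    using f unfolding clos_def by blast
  have mem: "v n \<in> V" "f \<in> V" for n
    using v f W(1) clos_mem by auto
  have "nrm (\<lambda>x. c * v n x - c * f x) = \<bar>c\<bar> * nrm (\<lambda>x. v n x - f x)" for n
    using nrm_scale[of "\<lambda>x. v n x - f x" c] mem by (simp add: algebra_simps)
  then have "(\<lambda>n. nrm (\<lambda>x. c * v n x - c * f x)) \<longlonglongrightarrow> 0"
    using tendsto_mult_right_zero[OF v(2)] by simp
  then show ?thesis unfolding clos_def using v(1) W(2) mem
    by (auto intro!: exI[of _ "\<lambda>n x. c * v n x"])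
qed

lemma clos_closed:
  assumes W: "W \<subseteq> V" and f: "\<And>n. f n \<in> clos W" and g: "g \<in> V"
    and lim: "(\<lambda>n::nat. nrm (\<lambda>x. f n x - g x)) \<longlonglongrightarrow> 0"
  shows "g \<in> clos W"
proof -
  have "\<exists>w\<in>W. nrm (\<lambda>x. w x - f n x) < inverse (real (Suc n))" for n
  proof -
    obtain v where v: "\<And>n. v n \<in> W" "(\<lambda>k::nat. nrm (\<lambda>x. v k x - f n x)) \<longlonglongrightarrow> 0"
      using f[of n] unfolding clos_def by blast
    have "0 < inverse (real (Suc n))" by simp
    from order_tendstoD(2)[OF v(2) this] show ?thesis
      using v(1) by (auto simp: eventually_sequentially)
  qed
  then obtain w where w: "\<And>n. w n \<in> W" "\<And>n. nrm (\<lambda>x. w n x - f n x) < inverse (real (Suc n))"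
    by metis
  have "(\<lambda>n. nrm (\<lambda>x. w n x - g x)) \<longlonglongrightarrow> 0"
  proof (rule Lim_null_comparison)
    have "norm (nrm (\<lambda>x. w n x - g x)) \<le> inverse (real (Suc n)) + nrm (\<lambda>x. f n x - g x)" for n
      using nrm_diff_triangle[of "w n" "f n" g] w(2)[of n] nrm_nonneg[of "\<lambda>x. w n x - g x"]
        subsetD[OF W w(1)[of n]] clos_mem[OF f, of n] g by simp
    then show "\<forall>\<^sub>F n in sequentially. norm (nrm (\<lambda>x. w n x - g x))
        \<le> inverse (real (Suc n)) + nrm (\<lambda>x. f n x - g x)" by simp
    show "(\<lambda>n. inverse (real (Suc n)) + nrm (\<lambda>x. f n x - g x)) \<longlonglongrightarrow> 0"
      using tendsto_add[OF LIMSEQ_inverse_real_of_nat lim] by simp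
  qed
  then show ?thesis unfolding clos_def using w(1) g by blast
qed

lemma clos_orthogonal:
  assumes W: "W \<subseteq> V" and f: "f \<in> V" and orth: "\<And>w. w \<in> W \<Longrightarrow> ip w f = 0" and g: "g \<in> clos W"
  shows "ip g f = 0"
proof -
  obtain v where v: "\<And>n. v n \<in> W" "(\<lambda>n::nat. nrm (\<lambda>x. v n x - g x)) \<longlonglongrightarrow> 0"
    using g unfolding clos_def by blast
  have "(\<lambda>n. ip (v n) f) \<longlonglongrightarrow> ip g f"
    by (rule ip_tendsto) (use v W clos_mem[OF g] f in auto)
  then show ?thesis using orth[OF v(1)] by (simp add: LIMSEQ_const_iff)
qed

lemma closed_span_orthogonal:
  assumes \<phi>: "\<And>u. u \<in> J \<Longrightarrow> \<phi> u \<in> V" and f: "f \<in> V"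
    and orth: "\<And>u. u \<in> J \<Longrightarrow> ip (\<phi> u) f = 0" and g: "g \<in> clos (lin_span \<phi> J)"
  shows "ip g f = 0"
proof (rule clos_orthogonal[OF _ f _ g])
  show "lin_span \<phi> J \<subseteq> V" using lin_span_mem \<phi> by blast
  fix w assume "w \<in> lin_span \<phi> J"
  then obtain F c where F: "finite F" "F \<subseteq> J" "w = (\<lambda>x. \<Sum>u\<in>F. c u * \<phi> u x)"
    using lin_spanE by metis
  show "ip w f = 0"
    using ip_lin_comb[OF F \<phi> f] F(2) orth by (auto intro!: sum.neutral)
qed

text \<open>A minimizing sequence \<open>w n\<close> for the squared distance from \<open>f\<close> to \<open>W\<close> is Cauchy by the
  parallelogram law. That no \<open>w n + a v\<close> is closer to \<open>f\<close> than the infimum \<open>d\<close> bounds the square of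
  the inner product of \<open>v\<close> and \<open>f - w n\<close> by a multiple of the excess \<open>Q (w n) - d\<close>, so the limit is
  orthogonal to \<open>v\<close>.\<close>
lemma projection:
  assumes W: "W \<subseteq> V" "(\<lambda>x. 0) \<in> W" "\<And>f g. f \<in> W \<Longrightarrow> g \<in> W \<Longrightarrow> (\<lambda>x. f x + g x) \<in> W"
    "\<And>c f. f \<in> W \<Longrightarrow> (\<lambda>x. c * f x) \<in> W"
    and f: "f \<in> V"
  obtains p where "p \<in> clos W" "\<And>w. w \<in> W \<Longrightarrow> ip w (\<lambda>x. f x - p x) = 0"
proof -
  define Q where "Q w = ip (\<lambda>x. f x - w x) (\<lambda>x. f x - w x)" for w
  define d where "d = Inf (Q ` W)"
  have WV: "w \<in> W \<Longrightarrow> w \<in> V" for w using W(1) by blast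
  have Q0: "w \<in> W \<Longrightarrow> 0 \<le> Q w" for w
    unfolding Q_def using WV f by (intro ip_nonneg) auto
  then have bdd: "bdd_below (Q ` W)" by (intro bdd_belowI[of _ 0]) auto
  have d_le: "w \<in> W \<Longrightarrow> d \<le> Q w" for w
    unfolding d_def by (rule cInf_lower[OF _ bdd]) auto
  have "\<exists>w\<in>W. Q w < d + inverse (real (Suc n))" for n
  proof -
    have "d < d + inverse (real (Suc n))" by simp
    from cInf_lessD[OF _ this[unfolded d_def]] W(2) show ?thesis unfolding d_def by auto
  qed
  then obtain w where w: "\<And>n. w n \<in> W" "\<And>n. Q (w n) < d + inverse (real (Suc n))" by metis
  have wV: "w n \<in> V" for n using w(1) WV by blast
  have par: "ip (\<lambda>x. w m x - w n x) (\<lambda>x. w m x - w n x) \<le> 2 * (inverse (real (Suc m)) + inverse (real (Suc n)))" for m n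
  proof -
    \<comment> \<open>The factor for the midpoint is kept opaque: with a numeral the simplifier would
      normalize the functions inside \<open>ip\<close> away from the shape that bilinearity expects.\<close>
    define c where "c = (1/2 :: real)"
    have "d \<le> Q (\<lambda>x. c * (w m x + w n x))"
      by (rule d_le) (use w(1) W(3,4) in blast)
    also have "\<dots> = ip f f - 2 * c * (ip f (w m) + ip f (w n))
        + c\<^sup>2 * (ip (w m) (w m) + 2 * ip (w m) (w n) + ip (w n) (w n))"
      unfolding Q_def using wV f
      by (simp add: ip_bilinear ip_commute[of "w n" "w m"] ip_commute[of "w _" f])
        (simp add: algebra_simps power2_eq_square)
    finally have "4 * d \<le> 4 * ip f f - 4 * ip f (w m) - 4 * ip f (w n)
        + ip (w m) (w m) + 2 * ip (w m) (w n) + ip (w n) (w n)"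
      by (simp add: c_def power2_eq_square field_simps)
    moreover have "Q (w k) = ip f f - 2 * ip f (w k) + ip (w k) (w k)" for k
      unfolding Q_def using wV f by (simp add: ip_bilinear ip_commute[of "w _" f])
    moreover have "ip (\<lambda>x. w m x - w n x) (\<lambda>x. w m x - w n x) =
        ip (w m) (w m) - 2 * ip (w m) (w n) + ip (w n) (w n)"
      using wV by (simp add: ip_bilinear ip_commute[of "w n" "w m"])
    ultimately have "ip (\<lambda>x. w m x - w n x) (\<lambda>x. w m x - w n x) \<le> 2 * Q (w m) + 2 * Q (w n) - 4 * d"
      by simp
    then show ?thesis using w(2)[of m] w(2)[of n] by simp
  qed
  obtain p where p: "p \<in> V" "(\<lambda>n. nrm (\<lambda>x. w n x - p x)) \<longlonglongrightarrow> 0"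
  proof (rule complete_nrm[of w])
    fix e :: real assume e: "0 < e"
    obtain N where "inverse (real (Suc N)) < e\<^sup>2 / 4"
      using reals_Archimedean[of "e\<^sup>2 / 4"] e by auto
    then have N: "4 * inverse (real (Suc N)) < e\<^sup>2" by (simp only: less_divide_eq_numeral1 mult.commute)
    have "nrm (\<lambda>x. w m x - w n x) < e" if mn: "m \<ge> N" "n \<ge> N" for m n
    proof -
      have "inverse (real (Suc m)) \<le> inverse (real (Suc N))" "inverse (real (Suc n)) \<le> inverse (real (Suc N))"
        using mn by (auto intro!: le_imp_inverse_le)
      then have "ip (\<lambda>x. w m x - w n x) (\<lambda>x. w m x - w n x) < e\<^sup>2"
        using N add_mono[of "inverse (real (Suc m))" "inverse (real (Suc N))"
            "inverse (real (Suc n))" "inverse (real (Suc N))"]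
        by (intro le_less_trans[OF par[of m n]]) simp
      then show ?thesis using e unfolding nrm_def by (intro real_less_lsqrt) auto
    qed
    then show "\<exists>N. \<forall>m\<ge>N. \<forall>n\<ge>N. nrm (\<lambda>x. w m x - w n x) < e" by blast
  qed (use wV in auto)
  have orth: "ip v (\<lambda>x. f x - p x) = 0" if v: "v \<in> W" for v
  proof -
    have vV: "v \<in> V" using v WV by blast
    have sq: "(ip v (\<lambda>x. f x - w n x))\<^sup>2 \<le> (Q (w n) - d) * ip v v" for n
    proof (rule nonneg_quadratic_discriminant)
      fix t
      have "Q (\<lambda>x. w n x + a * v x) = Q (w n) - 2 * a * ip v (\<lambda>x. f x - w n x) + a\<^sup>2 * ip v v" for a
        unfolding Q_def using wV[of n] f vV
        by (simp add: ip_bilinear ip_commute[of v f] ip_commute[of v "w n"] ip_commute[of "w n" f])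
          (simp add: algebra_simps power2_eq_square)
      from this[of "- t"] have "Q (\<lambda>x. w n x + (- t) * v x) =
          Q (w n) + 2 * t * ip v (\<lambda>x. f x - w n x) + t\<^sup>2 * ip v v" by simp
      moreover have "d \<le> Q (\<lambda>x. w n x + (- t) * v x)"
        by (rule d_le) (use w(1) v W(3,4) in blast)
      ultimately show "0 \<le> Q (w n) - d + 2 * t * ip v (\<lambda>x. f x - w n x) + t\<^sup>2 * ip v v"
        by simp
    qed (use vV ip_nonneg in auto)
    have "(\<lambda>n. (ip v (\<lambda>x. f x - w n x))\<^sup>2) \<longlonglongrightarrow> 0"
    proof (rule Lim_null_comparison)
      show "\<forall>\<^sub>F n in sequentially. norm ((ip v (\<lambda>x. f x - w n x))\<^sup>2) \<le> inverse (real (Suc n)) * ip v v"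
      proof (rule always_eventually, rule allI)
        fix n
        have "(Q (w n) - d) * ip v v \<le> inverse (real (Suc n)) * ip v v"
          using w(2)[of n] ip_nonneg[OF vV] by (intro mult_right_mono) auto
        then show "norm ((ip v (\<lambda>x. f x - w n x))\<^sup>2) \<le> inverse (real (Suc n)) * ip v v"
          using sq[of n] by simp
      qed
      show "(\<lambda>n. inverse (real (Suc n)) * ip v v) \<longlonglongrightarrow> 0"
        by (rule tendsto_mult_left_zero[OF LIMSEQ_inverse_real_of_nat])
    qed
    then have "(\<lambda>n. ip v (\<lambda>x. f x - w n x)) \<longlonglongrightarrow> 0" by simp
    moreover have "(\<lambda>n. ip v (\<lambda>x. f x - w n x)) \<longlonglongrightarrow> ip v f - ip p v"
    proof -
      have "ip v (\<lambda>x. f x - w n x) = ip v f - ip (w n) v" for n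
        using wV[of n] f vV by (simp add: ip_bilinear ip_commute[of v "w n"])
      moreover have "(\<lambda>n. ip v f - ip (w n) v) \<longlonglongrightarrow> ip v f - ip p v"
        by (intro tendsto_diff tendsto_const ip_tendsto) (use wV p vV in auto)
      ultimately show ?thesis by presburger
    qed
    ultimately have "0 = ip v f - ip p v" by (rule LIMSEQ_unique)
    then show ?thesis using p f vV by (simp add: ip_bilinear ip_commute[of v p])
  qed
  have "p \<in> clos W" using p w(1) unfolding clos_def by blast
  from that[OF this orth] show ?thesis .
qed

lemma span_projection:
  assumes "\<And>u. u \<in> J \<Longrightarrow> \<phi> u \<in> V" and "f \<in> V"
  shows "\<exists>p \<in> clos (lin_span \<phi> J). \<forall>u\<in>J. ip (\<phi> u) (\<lambda>x. f x - p x) = 0"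
proof (rule projection[of "lin_span \<phi> J" f])
  show "lin_span \<phi> J \<subseteq> V" using lin_span_mem assms(1) by blast
  show "(\<lambda>x. 0) \<in> lin_span \<phi> J" by (rule lin_span_zero)
  show "(\<lambda>x. g x + h x) \<in> lin_span \<phi> J" if "g \<in> lin_span \<phi> J" "h \<in> lin_span \<phi> J" for g h
    using that by (rule lin_span_add)
  show "(\<lambda>x. c * g x) \<in> lin_span \<phi> J" if "g \<in> lin_span \<phi> J" for c g
    using that by (rule lin_span_scale)
  show "f \<in> V" by fact
  show ?thesis if "p \<in> clos (lin_span \<phi> J)" "\<And>w. w \<in> lin_span \<phi> J \<Longrightarrow> ip w (\<lambda>x. f x - p x) = 0" for p
    by (intro bexI[OF _ that(1)] ballI that(2) lin_span_base)
qed

end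

section \<open>Reproducing kernel Hilbert spaces\<close>

lemma is_rkhsD:
  assumes rkhs: "is_rkhs J K H ip"
  shows "f \<in> H \<Longrightarrow> restr J f = f"
    and "(\<lambda>x. 0) \<in> H"
    and "f \<in> H \<Longrightarrow> g \<in> H \<Longrightarrow> (\<lambda>x. f x + g x) \<in> H"
    and "f \<in> H \<Longrightarrow> (\<lambda>x. c * f x) \<in> H"
    and "f \<notin> H \<or> g \<notin> H \<Longrightarrow> ip f g = 0"
    and "f \<in> H \<Longrightarrow> g \<in> H \<Longrightarrow> ip f g = ip g f"
    and "f \<in> H \<Longrightarrow> g \<in> H \<Longrightarrow> h \<in> H \<Longrightarrow> ip (\<lambda>x. f x + g x) h = ip f h + ip g h"
    and "f \<in> H \<Longrightarrow> g \<in> H \<Longrightarrow> ip (\<lambda>x. c * f x) g = c * ip f g"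
    and "f \<in> H \<Longrightarrow> f \<noteq> (\<lambda>x. 0) \<Longrightarrow> ip f f > 0"
    and "u \<in> J \<Longrightarrow> restr J (\<lambda>v. K v u) \<in> H"
    and "u \<in> J \<Longrightarrow> f \<in> H \<Longrightarrow> ip f (restr J (\<lambda>v. K v u)) = f u"
proof -
  note clauses = rkhs[unfolded is_rkhs_def]
  note tail = clauses[THEN conjunct2, THEN conjunct2, THEN conjunct2, THEN conjunct2, THEN conjunct2]
  show "f \<in> H \<Longrightarrow> g \<in> H \<Longrightarrow> ip f g = ip g f"
    by (rule tail[THEN conjunct1, rule_format])
  show "f \<in> H \<Longrightarrow> g \<in> H \<Longrightarrow> h \<in> H \<Longrightarrow> ip (\<lambda>x. f x + g x) h = ip f h + ip g h"
    by (rule tail[THEN conjunct2, THEN conjunct1, rule_format])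
  show "f \<in> H \<Longrightarrow> g \<in> H \<Longrightarrow> ip (\<lambda>x. c * f x) g = c * ip f g"
    by (rule tail[THEN conjunct2, THEN conjunct2, THEN conjunct1, rule_format])
qed (use rkhs in \<open>unfold is_rkhs_def, simp_all\<close>)

lemma semi_hilbert_of_rkhs:
  assumes rkhs: "is_rkhs J K H ip"
  shows "semi_hilbert H ip"
proof (unfold_locales, goal_cases)
  case (7 f)
  show ?case
  proof (cases "f = (\<lambda>x. 0)")
    case True
    then show ?thesis using is_rkhsD(8)[OF rkhs 7 7, of 0] by simp
  qed (use is_rkhsD(9)[OF rkhs 7] in simp)
next
  case (8 F)
  then show ?case using rkhs unfolding is_rkhs_def by simp
qed (use is_rkhsD[OF rkhs] in simp_all)

text \<open>By the reproducing property only \<open>0\<close> is orthogonal to all kernel sections, so the projection of \<open>f\<close>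
  onto their closed span is \<open>f\<close> itself, and \<open>f\<close> is a limit of linear combinations of sections. On such
  combinations both inner products are given by \<open>K\<close>, hence the approximating sequence also converges
  in the second space. Norm convergence implies pointwise convergence, so the two limits agree.\<close>
lemma rkhs_mono:
  assumes 1: "is_rkhs J K H1 ip1" and 2: "is_rkhs J K H2 ip2" and f: "f \<in> H1"
  shows "f \<in> H2 \<and> ip2 f f = ip1 f f"
proof -
  interpret h1: semi_hilbert H1 ip1 using 1 by (rule semi_hilbert_of_rkhs)
  interpret h2: semi_hilbert H2 ip2 using 2 by (rule semi_hilbert_of_rkhs)
  define \<kappa> where "\<kappa> u = restr J (\<lambda>v. K v u)" for u
  have \<kappa>1: "\<kappa> u \<in> H1" "g \<in> H1 \<Longrightarrow> ip1 g (\<kappa> u) = g u" if "u \<in> J" for u g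
    using is_rkhsD(10,11)[OF 1] that unfolding \<kappa>_def by simp_all
  have \<kappa>2: "\<kappa> u \<in> H2" "g \<in> H2 \<Longrightarrow> ip2 g (\<kappa> u) = g u" if "u \<in> J" for u g
    using is_rkhsD(10,11)[OF 2] that unfolding \<kappa>_def by simp_all
  have ext: "g = h" if "\<And>u. u \<in> J \<Longrightarrow> g u = h u" "restr J g = g" "restr J h = h" for g h
  proof
    fix x show "g x = h x"
      using that(1)[of x] fun_cong[OF that(2), of x] fun_cong[OF that(3), of x]
      by (cases "x \<in> J") (auto simp: restr_def)
  qed
  have restr1: "restr J g = g" if "g \<in> H1" for g using is_rkhsD(1)[OF 1] that by simp
  have restr2: "restr J g = g" if "g \<in> H2" for g using is_rkhsD(1)[OF 2] that by simp
  let ?S = "lin_span \<kappa> J"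
  have S1: "g \<in> H1" and S2: "g \<in> H2" if "g \<in> ?S" for g
    using that h1.lin_span_mem[of J \<kappa>] h2.lin_span_mem[of J \<kappa>] \<kappa>1(1) \<kappa>2(1) by blast+
  have S_ip: "ip1 g g = ip2 g g" if g: "g \<in> ?S" for g
  proof -
    obtain F c where F: "finite F" "F \<subseteq> J" "g = (\<lambda>x. \<Sum>u\<in>F. c u * \<kappa> u x)"
      using lin_spanE[OF g] by metis
    have "ip1 g g = (\<Sum>u\<in>F. c u * ip1 (\<kappa> u) g)"
      using F \<kappa>1(1) S1[OF g] by (rule h1.ip_lin_comb)
    also have "\<dots> = (\<Sum>u\<in>F. c u * ip2 (\<kappa> u) g)"
      using F(2) \<kappa>1 \<kappa>2 S1[OF g] S2[OF g] h1.ip_commute[OF _ S1[OF g]] h2.ip_commute[OF _ S2[OF g]]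
      by (intro sum.cong) auto
    also have "\<dots> = ip2 g g"
      using h2.ip_lin_comb[OF F \<kappa>2(1) S2[OF g]] by simp
    finally show ?thesis .
  qed
  obtain p where p: "p \<in> h1.clos ?S" "\<And>u. u \<in> J \<Longrightarrow> ip1 (\<kappa> u) (\<lambda>x. f x - p x) = 0"
    using h1.span_projection[of J \<kappa> f] \<kappa>1(1) f by blast
  have p1: "p \<in> H1" using p(1) by (rule h1.clos_mem)
  have "f = p"
  proof (rule ext)
    fix u assume u: "u \<in> J"
    have "ip1 (\<lambda>x. f x - p x) (\<kappa> u) = 0"
      using p(2)[OF u] h1.ip_commute[of "\<kappa> u" "\<lambda>x. f x - p x"] \<kappa>1(1)[OF u] f p1 by simp
    then show "f u = p u" using \<kappa>1(2)[OF u, of "\<lambda>x. f x - p x"] f p1 by simp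
  qed (use restr1 f p1 in auto)
  then obtain w where w: "\<And>n. w n \<in> ?S" "(\<lambda>n::nat. h1.nrm (\<lambda>x. w n x - f x)) \<longlonglongrightarrow> 0"
    using p(1) unfolding h1.clos_def by blast
  have diffS: "(\<lambda>x. w m x - w n x) \<in> ?S" for m n
    using lin_span_add[OF w(1)[of m] lin_span_scale[OF w(1)[of n], of "-1"]] by simp
  obtain g where g: "g \<in> H2" "(\<lambda>n. h2.nrm (\<lambda>x. w n x - g x)) \<longlonglongrightarrow> 0"
  proof (rule h2.complete_nrm[of w])
    fix e :: real assume "0 < e"
    then have "0 < e / 2" by simp
    from order_tendstoD(2)[OF w(2) this] obtain N where
      N: "\<And>n. n \<ge> N \<Longrightarrow> h1.nrm (\<lambda>x. w n x - f x) < e / 2"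
      unfolding eventually_sequentially by blast
    have "h2.nrm (\<lambda>x. w m x - w n x) < e" if mn: "m \<ge> N" "n \<ge> N" for m n
    proof -
      have "h2.nrm (\<lambda>x. w m x - w n x) = h1.nrm (\<lambda>x. w m x - w n x)"
        unfolding h1.nrm_def h2.nrm_def using S_ip[OF diffS] by simp
      also have "\<dots> \<le> h1.nrm (\<lambda>x. w m x - f x) + h1.nrm (\<lambda>x. f x - w n x)"
        using w(1) S1 f by (intro h1.nrm_diff_triangle) auto
      also have "\<dots> < e"
        using N[OF mn(1)] N[OF mn(2)] h1.nrm_diff_commute[OF f S1[OF w(1)[of n]]] by simp
      finally show ?thesis .
    qed
    then show "\<exists>N. \<forall>m\<ge>N. \<forall>n\<ge>N. h2.nrm (\<lambda>x. w m x - w n x) < e" by blast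
  qed (use w(1) S2 in auto)
  have "f = g"
  proof (rule ext)
    fix u assume u: "u \<in> J"
    have "(\<lambda>n. w n u) \<longlonglongrightarrow> f u"
      using h1.ip_tendsto[of w f "\<kappa> u"] w S1 f \<kappa>1[OF u] by simp
    moreover have "(\<lambda>n. w n u) \<longlonglongrightarrow> g u"
      using h2.ip_tendsto[of w g "\<kappa> u"] w(1) S2 g \<kappa>2[OF u] by simp
    ultimately show "f u = g u" by (rule LIMSEQ_unique)
  qed (use restr1 restr2 f g in auto)
  have "(\<lambda>n. h1.nrm (w n)) \<longlonglongrightarrow> h1.nrm f"
    using w S1 f by (intro h1.nrm_tendsto) auto
  moreover have "(\<lambda>n. h1.nrm (w n)) \<longlonglongrightarrow> h2.nrm f"
  proof -
    have "(\<lambda>n. h2.nrm (w n)) \<longlonglongrightarrow> h2.nrm g"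
      using w(1) S2 g by (intro h2.nrm_tendsto) auto
    then show ?thesis unfolding \<open>f = g\<close> h1.nrm_def h2.nrm_def using S_ip[OF w(1)] by simp
  qed
  ultimately have "h1.nrm f = h2.nrm f" by (rule LIMSEQ_unique)
  then have "ip1 f f = ip2 f f" unfolding h1.nrm_def h2.nrm_def by simp
  then show ?thesis using \<open>f = g\<close> g(1) by simp
qed

lemma rkhs_unique:
  assumes 1: "is_rkhs J K H1 ip1" and 2: "is_rkhs J K H2 ip2"
  shows "H1 = H2 \<and> ip1 = ip2"
proof -
  interpret h1: semi_hilbert H1 ip1 using 1 by (rule semi_hilbert_of_rkhs)
  interpret h2: semi_hilbert H2 ip2 using 2 by (rule semi_hilbert_of_rkhs)
  have H: "H1 = H2" using rkhs_mono[OF 1 2] rkhs_mono[OF 2 1] by blast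
  have sq: "ip1 f f = ip2 f f" if "f \<in> H1" for f using rkhs_mono[OF 1 2 that] by simp
  have "ip1 f g = ip2 f g" for f g
  proof (cases "f \<in> H1 \<and> g \<in> H1")
    case True
    then have fg: "f \<in> H1" "g \<in> H1" "f \<in> H2" "g \<in> H2" using H by auto
    have "ip1 (\<lambda>x. f x + g x) (\<lambda>x. f x + g x) = ip1 f f + 2 * ip1 f g + ip1 g g"
      using fg by (simp add: h1.ip_bilinear h1.ip_commute[of g f])
    moreover have "ip2 (\<lambda>x. f x + g x) (\<lambda>x. f x + g x) = ip2 f f + 2 * ip2 f g + ip2 g g"
      using fg by (simp add: h2.ip_bilinear h2.ip_commute[of g f])
    ultimately show ?thesis using sq[of f] sq[of g] sq[of "\<lambda>x. f x + g x"] fg by simp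
  next
    case False
    have "ip1 f g = 0" using is_rkhsD(5)[OF 1] False by blast
    moreover have "ip2 f g = 0" using is_rkhsD(5)[OF 2] False H by blast
    ultimately show ?thesis by simp
  qed
  with H show ?thesis by blast
qed

lemma rkhs_inner_eq:
  assumes "is_rkhs J K H ip"
  shows "rkhs_inner K J f g = ip (restr J f) (restr J g)"
proof -
  have "(THE (H, ip). is_rkhs J K H ip) = (H, ip)"
    by (rule the_equality) (use assms rkhs_unique in \<open>auto split: prod.splits\<close>)
  then show ?thesis unfolding rkhs_inner_def by simp
qed

context semi_hilbert
begin

text \<open>Existence: any representation of \<open>K\<close> as a Gram kernel of vectors \<open>\<phi> u\<close> identifies the closed span of
  these vectors with the reproducing kernel Hilbert space, through \<open>T\<close>. An element of the span is
  determined by its image only up to a null vector, which is why \<open>ipH\<close> is defined by a choice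
  of representatives.\<close>
lemma rkhs_of_feature_map:
  fixes \<phi> :: "real \<Rightarrow> 'a \<Rightarrow> real"
  assumes \<phi>: "\<And>u. u \<in> J \<Longrightarrow> \<phi> u \<in> V"
    and K: "\<And>u v. u \<in> J \<Longrightarrow> v \<in> J \<Longrightarrow> K v u = ip (\<phi> v) (\<phi> u)"
  defines "L \<equiv> clos (lin_span \<phi> J)" and "T \<equiv> \<lambda>a. restr J (\<lambda>v. ip (\<phi> v) a)"
  shows "\<exists>ipH. is_rkhs J K (T ` L) ipH \<and> (\<forall>a\<in>L. \<forall>b\<in>L. ipH (T a) (T b) = ip a b)"
proof -
  define rep where "rep f = (SOME a. a \<in> L \<and> T a = f)" for f
  define ipH where "ipH f g = (if f \<in> T ` L \<and> g \<in> T ` L then ip (rep f) (rep g) else 0)" for f g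
  have span: "lin_span \<phi> J \<subseteq> V" using lin_span_mem \<phi> by blast
  have LV: "a \<in> V" if "a \<in> L" for a using that clos_mem unfolding L_def by blast
  have L_add: "(\<lambda>x. a x + b x) \<in> L" if "a \<in> L" "b \<in> L" for a b
    using that unfolding L_def by (intro clos_add span lin_span_add)
  have L_scale: "(\<lambda>x. c * a x) \<in> L" if "a \<in> L" for a c
    using that unfolding L_def by (intro clos_scale span lin_span_scale)
  have L_zero: "(\<lambda>x. 0) \<in> L"
    unfolding L_def by (intro clos_base span lin_span_zero)
  have L_diff: "(\<lambda>x. a x - b x) \<in> L" if "a \<in> L" "b \<in> L" for a b
    using L_add[OF that(1) L_scale[OF that(2), of "-1"]] by simp
  have T_zero: "T (\<lambda>x. 0) = (\<lambda>x. 0)"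
    using \<phi> by (auto simp: T_def restr_def ip_commute[of _ "\<lambda>x. 0"] ip_zero_left)
  have T_add: "T (\<lambda>x. a x + b x) = (\<lambda>x. T a x + T b x)" if "a \<in> L" "b \<in> L" for a b
    using \<phi> LV that by (auto simp: T_def restr_def ip_bilinear)
  have T_scale: "T (\<lambda>x. c * a x) = (\<lambda>x. c * T a x)" if "a \<in> L" for a c
    using \<phi> LV that by (auto simp: T_def restr_def ip_bilinear)
  have T_diff: "T (\<lambda>x. a x - b x) = (\<lambda>x. T a x - T b x)" if "a \<in> L" "b \<in> L" for a b
    using \<phi> LV that by (auto simp: T_def restr_def ip_bilinear)
  have T_restr: "restr J (T a) = T a" for a by (auto simp: T_def restr_def)
  have null: "ip a a = 0" if a: "a \<in> L" and Ta: "T a = (\<lambda>x. 0)" for a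
  proof (rule closed_span_orthogonal[OF \<phi>])
    show "a \<in> clos (lin_span \<phi> J)" "a \<in> V" using a LV unfolding L_def by auto
    show "ip (\<phi> u) a = 0" if "u \<in> J" for u
      using fun_cong[OF Ta, of u] that by (simp add: T_def restr_def)
  qed
  have rep: "rep (T a) \<in> L" "T (rep (T a)) = T a" if "a \<in> L" for a
    using someI[of "\<lambda>b. b \<in> L \<and> T b = T a" a] that unfolding rep_def by auto
  have rep_ip: "ip (rep (T a)) b = ip a b" if a: "a \<in> L" and b: "b \<in> V" for a b
  proof (rule ip_eq_of_nrm_diff_zero)
    have "T (\<lambda>x. rep (T a) x - a x) = (\<lambda>x. 0)"
      using T_diff[OF rep(1)[OF a] a] rep(2)[OF a] by simp
    then show "nrm (\<lambda>x. rep (T a) x - a x) = 0"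
      using null[OF L_diff[OF rep(1)[OF a] a]] by (simp add: nrm_def)
  qed (use a b LV rep in auto)
  have ipH: "ipH (T a) (T b) = ip a b" if a: "a \<in> L" and b: "b \<in> L" for a b
  proof -
    have "ipH (T a) (T b) = ip (rep (T a)) (rep (T b))" using a b by (simp add: ipH_def)
    also have "\<dots> = ip a (rep (T b))" using rep_ip[OF a] rep(1)[OF b] LV by blast
    also have "\<dots> = ip b a" using rep_ip[OF b LV[OF a]] ip_commute LV rep(1)[OF b] a by metis
    finally show ?thesis using ip_commute LV a b by metis
  qed
  have \<phi>L: "\<phi> u \<in> L" if "u \<in> J" for u
    unfolding L_def using that by (intro clos_base span lin_span_base)
  have T\<phi>: "T (\<phi> u) = restr J (\<lambda>v. K v u)" if "u \<in> J" for u
    using K that by (auto simp: T_def restr_def)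
  have "is_rkhs J K (T ` L) ipH"
    unfolding is_rkhs_def
  proof (intro conjI ballI allI impI)
    fix f assume "f \<in> T ` L" then show "restr J f = f" using T_restr by blast
  next
    show "(\<lambda>x. 0) \<in> T ` L" using imageI[OF L_zero, of T] by (simp add: T_zero)
  next
    fix f g assume "f \<in> T ` L" "g \<in> T ` L"
    then obtain a b where "a \<in> L" "b \<in> L" "f = T a" "g = T b" by blast
    then show "(\<lambda>x. f x + g x) \<in> T ` L" using imageI[OF L_add[of a b], of T] by (simp add: T_add)
  next
    fix c f assume "f \<in> T ` L"
    then obtain a where "a \<in> L" "f = T a" by blast
    then show "(\<lambda>x. c * f x) \<in> T ` L" using imageI[OF L_scale[of a c], of T] by (simp add: T_scale)
  next
    fix f g assume "f \<notin> T ` L \<or> g \<notin> T ` L" then show "ipH f g = 0" unfolding ipH_def by auto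
  next
    fix f g assume "f \<in> T ` L" "g \<in> T ` L"
    then obtain a b where "a \<in> L" "b \<in> L" "f = T a" "g = T b" by blast
    then show "ipH f g = ipH g f" using ip_commute[OF LV LV, of a b] by (simp add: ipH)
  next
    fix f g h assume "f \<in> T ` L" "g \<in> T ` L" "h \<in> T ` L"
    then obtain a b c where *: "a \<in> L" "b \<in> L" "c \<in> L" "f = T a" "g = T b" "h = T c" by blast
    have "ipH (\<lambda>x. f x + g x) h = ip (\<lambda>x. a x + b x) c"
      using ipH[OF L_add[OF *(1,2)] *(3)] * by (simp add: T_add)
    then show "ipH (\<lambda>x. f x + g x) h = ipH f h + ipH g h"
      using * LV by (simp add: ipH ip_bilinear)
  next
    fix c f g assume "f \<in> T ` L" "g \<in> T ` L"
    then obtain a b where *: "a \<in> L" "b \<in> L" "f = T a" "g = T b" by blast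
    have "ipH (\<lambda>x. c * f x) g = ip (\<lambda>x. c * a x) b"
      using ipH[OF L_scale[OF *(1), of c] *(2)] * by (simp add: T_scale)
    then show "ipH (\<lambda>x. c * f x) g = c * ipH f g"
      using * LV by (simp add: ipH ip_bilinear)
  next
    fix f assume f: "f \<in> T ` L" "f \<noteq> (\<lambda>x. 0)"
    then obtain a where a: "a \<in> L" "f = T a" by blast
    have "ip a a \<noteq> 0"
    proof
      assume z: "ip a a = 0"
      have "ip (\<phi> u) a = 0" if "u \<in> J" for u
        using Cauchy_Schwarz[OF \<phi>[OF that] LV[OF a(1)]] z by (simp add: nrm_def)
      then have "T a = (\<lambda>x. 0)" by (auto simp: T_def restr_def)
      then show False using f a by simp
    qed
    then show "0 < ipH f f" using ipH a ip_nonneg[OF LV[OF a(1)]] by simp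
  next
    fix f :: "nat \<Rightarrow> real \<Rightarrow> real"
    assume f: "\<forall>n. f n \<in> T ` L"
      and cauchy: "\<forall>e>0. \<exists>N. \<forall>m\<ge>N. \<forall>n\<ge>N.
           sqrt (ipH (\<lambda>x. f m x - f n x) (\<lambda>x. f m x - f n x)) < e"
    then have "\<forall>n. \<exists>a. a \<in> L \<and> f n = T a" by blast
    then obtain a where a: "\<And>n. a n \<in> L" "\<And>n. f n = T (a n)" by metis
    have nrm_T: "sqrt (ipH (\<lambda>x. T b x - T c x) (\<lambda>x. T b x - T c x)) = nrm (\<lambda>x. b x - c x)"
      if "b \<in> L" "c \<in> L" for b c
      using T_diff[OF that] ipH[OF L_diff[OF that] L_diff[OF that]] by (simp add: nrm_def)
    obtain b where b: "b \<in> V" "(\<lambda>n. nrm (\<lambda>x. a n x - b x)) \<longlonglongrightarrow> 0"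
    proof (rule complete_nrm[of a])
      show "a n \<in> V" for n using a LV by blast
      show "\<exists>N. \<forall>m\<ge>N. \<forall>n\<ge>N. nrm (\<lambda>x. a m x - a n x) < e" if "0 < e" for e
        using cauchy that unfolding a(2) nrm_T[OF a(1) a(1)] by blast
    qed
    have bL: "b \<in> L" unfolding L_def by (rule clos_closed[OF span _ b]) (use a in \<open>simp add: L_def\<close>)
    have "(\<lambda>n. sqrt (ipH (\<lambda>x. f n x - T b x) (\<lambda>x. f n x - T b x))) \<longlonglongrightarrow> 0"
      using b(2) unfolding a(2) nrm_T[OF a(1) bL] .
    then show "\<exists>g\<in>T ` L. (\<lambda>n. sqrt (ipH (\<lambda>x. f n x - g x) (\<lambda>x. f n x - g x))) \<longlonglongrightarrow> 0"
      using bL by blast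
  next
    fix u assume "u \<in> J" then show "restr J (\<lambda>v. K v u) \<in> T ` L" using imageI[OF \<phi>L, of u T] by (simp add: T\<phi>)
  next
    fix u f assume u: "u \<in> J" and "f \<in> T ` L"
    then obtain a where a: "a \<in> L" "f = T a" by blast
    have "ipH f (restr J (\<lambda>v. K v u)) = ip a (\<phi> u)"
      using ipH[OF a(1) \<phi>L[OF u]] T\<phi>[OF u] a by simp
    also have "\<dots> = ip (\<phi> u) a" using ip_commute LV[OF a(1)] \<phi>[OF u] by blast
    finally show "ipH f (restr J (\<lambda>v. K v u)) = f u" using a u by (simp add: T_def restr_def)
  qed
  then show ?thesis using ipH by blast
qed

lemma rkhs_inner_feature_map:
  fixes \<phi> :: "real \<Rightarrow> 'a \<Rightarrow> real"
  assumes \<phi>: "\<And>u. u \<in> J \<Longrightarrow> \<phi> u \<in> V"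
    and K: "\<And>u v. u \<in> J \<Longrightarrow> v \<in> J \<Longrightarrow> K v u = ip (\<phi> v) (\<phi> u)"
    and a: "a \<in> clos (lin_span \<phi> J)" and b: "b \<in> clos (lin_span \<phi> J)"
    and f: "\<And>u. u \<in> J \<Longrightarrow> f u = ip (\<phi> u) a" and g: "\<And>u. u \<in> J \<Longrightarrow> g u = ip (\<phi> u) b"
  shows "rkhs_inner K J f g = ip a b"
proof -
  define T where "T a = restr J (\<lambda>v. ip (\<phi> v) a)" for a
  obtain ipH where ipH: "is_rkhs J K (T ` clos (lin_span \<phi> J)) ipH"
    "\<forall>a\<in>clos (lin_span \<phi> J). \<forall>b\<in>clos (lin_span \<phi> J). ipH (T a) (T b) = ip a b"
    using rkhs_of_feature_map[of J \<phi> K] \<phi> K unfolding T_def by blast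
  have "restr J f = T a" "restr J g = T b"
    using f g by (auto simp: T_def restr_def)
  then show ?thesis using rkhs_inner_eq[OF ipH(1), of f g] ipH(2) a b by simp
qed

end

section \<open>Square-integrable random variables\<close>

definition L2 :: "'a measure \<Rightarrow> ('a \<Rightarrow> real) set" where
  "L2 M = {f \<in> borel_measurable M. integrable M (\<lambda>x. (f x)\<^sup>2)}"

definition L2_inner :: "'a measure \<Rightarrow> ('a \<Rightarrow> real) \<Rightarrow> ('a \<Rightarrow> real) \<Rightarrow> real" where
  "L2_inner M f g = (\<integral>x. f x * g x \<partial>M)"

lemma L2_measurable [measurable_dest]: "f \<in> L2 M \<Longrightarrow> f \<in> borel_measurable M"
  by (simp add: L2_def)

lemma L2_square_integrable: "f \<in> L2 M \<Longrightarrow> integrable M (\<lambda>x. (f x)\<^sup>2)"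
  by (simp add: L2_def)

lemma L2_mult_integrable:
  assumes f: "f \<in> L2 M" and g: "g \<in> L2 M"
  shows "integrable M (\<lambda>x. f x * g x)"
proof (rule Bochner_Integration.integrable_bound)
  show "integrable M (\<lambda>x. (f x)\<^sup>2 + (g x)\<^sup>2)"
    using f g by (intro Bochner_Integration.integrable_add L2_square_integrable)
  show "(\<lambda>x. f x * g x) \<in> borel_measurable M"
    using f g by (intro borel_measurable_times L2_measurable)
  have "\<bar>f x * g x\<bar> \<le> (f x)\<^sup>2 + (g x)\<^sup>2" for x
  proof -
    have "2 * \<bar>f x * g x\<bar> \<le> (f x)\<^sup>2 + (g x)\<^sup>2"
      using sum_squares_bound[of "\<bar>f x\<bar>" "\<bar>g x\<bar>"] by (simp add: abs_mult mult.assoc)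
    then show ?thesis by linarith
  qed
  then show "AE x in M. norm (f x * g x) \<le> norm ((f x)\<^sup>2 + (g x)\<^sup>2)"
    by simp
qed

lemma L2_add:
  assumes f: "f \<in> L2 M" and g: "g \<in> L2 M"
  shows "(\<lambda>x. f x + g x) \<in> L2 M"
proof -
  have "integrable M (\<lambda>x. (f x)\<^sup>2 + (g x)\<^sup>2 + 2 * (f x * g x))"
    using f g
    by (intro Bochner_Integration.integrable_add L2_square_integrable integrable_mult_right L2_mult_integrable)
  then show ?thesis using f g by (simp add: L2_def power2_sum mult.assoc borel_measurable_add)
qed

lemma L2_scale: "f \<in> L2 M \<Longrightarrow> (\<lambda>x. c * f x) \<in> L2 M"
  by (simp add: L2_def power_mult_distrib borel_measurable_times)

lemma (in prob_space) L2_const: "(\<lambda>x. c) \<in> L2 M"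
  by (simp add: L2_def)

lemma (in prob_space) L2_integrable: "f \<in> L2 M \<Longrightarrow> integrable M f"
  using L2_mult_integrable[OF _ L2_const[of 1]] by simp

lemma (in prob_space) L1_le_L2:
  assumes f: "f \<in> L2 M"
  shows "(\<integral>x. \<bar>f x\<bar> \<partial>M) \<le> sqrt (L2_inner M f f)"
proof (rule real_le_rsqrt)
  have "variance (\<lambda>x. \<bar>f x\<bar>) = (\<integral>x. \<bar>f x\<bar>\<^sup>2 \<partial>M) - (\<integral>x. \<bar>f x\<bar> \<partial>M)\<^sup>2"
    using f by (intro variance_eq) (auto intro: L2_integrable L2_square_integrable)
  then show "(\<integral>x. \<bar>f x\<bar> \<partial>M)\<^sup>2 \<le> L2_inner M f f"
    using variance_positive[of "\<lambda>x. \<bar>f x\<bar>"] by (simp add: L2_inner_def power2_eq_square)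
qed

text \<open>Riesz--Fischer: a Cauchy sequence in \<open>L\<^sup>2\<close> is Cauchy in \<open>L\<^sup>1\<close>, so a subsequence converges almost
  everywhere, and Fatou's lemma shows that its pointwise limit is a limit in \<open>L\<^sup>2\<close>.\<close>
lemma (in prob_space) L2_complete:
  assumes F: "\<And>n. F n \<in> L2 M"
    and cauchy: "\<forall>e>0. \<exists>N. \<forall>m\<ge>N. \<forall>n\<ge>N.
      sqrt (L2_inner M (\<lambda>x. F m x - F n x) (\<lambda>x. F m x - F n x)) < e"
  shows "\<exists>g\<in>L2 M. (\<lambda>n::nat. sqrt (L2_inner M (\<lambda>x. F n x - g x) (\<lambda>x. F n x - g x))) \<longlonglongrightarrow> 0"
proof -
  have [measurable]: "F n \<in> borel_measurable M" for n using F by (rule L2_measurable)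
  have diff: "(\<lambda>x. f x - g x) \<in> L2 M" if "f \<in> L2 M" "g \<in> L2 M" for f g
    using L2_add[OF that(1) L2_scale[OF that(2), of "-1"]] by simp
  have ip_sq: "L2_inner M f f = (\<integral>x. (f x)\<^sup>2 \<partial>M)" for f
    by (simp add: L2_inner_def power2_eq_square)
  have "\<exists>N. \<forall>i\<ge>N. \<forall>j\<ge>N. (LINT x|M. norm (F i x - F j x)) < e" if e: "0 < e" for e
  proof -
    obtain N where N: "\<And>m n. m \<ge> N \<Longrightarrow> n \<ge> N \<Longrightarrow>
        sqrt (L2_inner M (\<lambda>x. F m x - F n x) (\<lambda>x. F m x - F n x)) < e"
      using cauchy[rule_format, OF e] by blast
    have "(LINT x|M. norm (F i x - F j x)) < e" if "i \<ge> N" "j \<ge> N" for i j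
      using le_less_trans[OF L1_le_L2[OF diff[OF F F]] N[OF that]] by simp
    then show ?thesis by blast
  qed
  then obtain r where r: "strict_mono r" "AE x in M. Cauchy (\<lambda>i. F (r i) x)"
    using cauchy_L1_AE_cauchy_subseq[of M F] L2_integrable[OF F] by blast
  define g where "g x = lim (\<lambda>i. F (r i) x)" for x
  have g_meas [measurable]: "g \<in> borel_measurable M"
    unfolding g_def by (rule borel_measurable_lim_metric) simp
  have g_lim: "AE x in M. (\<lambda>i. F (r i) x) \<longlonglongrightarrow> g x"
    using r(2) by eventually_elim (simp add: g_def Cauchy_convergent_iff convergent_LIMSEQ_iff)
  have close: "\<exists>N. \<forall>n\<ge>N. integrable M (\<lambda>x. (F n x - g x)\<^sup>2) \<and> (\<integral>x. (F n x - g x)\<^sup>2 \<partial>M) \<le> e\<^sup>2"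
    if e: "0 < e" for e
  proof -
    obtain N where N: "\<And>m n. m \<ge> N \<Longrightarrow> n \<ge> N \<Longrightarrow>
        sqrt (\<integral>x. (F m x - F n x)\<^sup>2 \<partial>M) < e"
      using cauchy[rule_format, OF e] unfolding ip_sq by blast
    have "integrable M (\<lambda>x. (F n x - g x)\<^sup>2) \<and> (\<integral>x. (F n x - g x)\<^sup>2 \<partial>M) \<le> e\<^sup>2" if n: "n \<ge> N" for n
    proof -
      have "(\<integral>\<^sup>+x. ennreal ((F n x - g x)\<^sup>2) \<partial>M)
          = (\<integral>\<^sup>+x. liminf (\<lambda>i. ennreal ((F n x - F (r i) x)\<^sup>2)) \<partial>M)"
      proof (rule nn_integral_cong_AE)
        show "AE x in M. ennreal ((F n x - g x)\<^sup>2) = liminf (\<lambda>i. ennreal ((F n x - F (r i) x)\<^sup>2))"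
          using g_lim
        proof eventually_elim
          case (elim x)
          then have "(\<lambda>i. ennreal ((F n x - F (r i) x)\<^sup>2)) \<longlonglongrightarrow> ennreal ((F n x - g x)\<^sup>2)"
            by (intro tendsto_ennrealI tendsto_intros)
          then show ?case by (rule lim_imp_Liminf[OF trivial_limit_sequentially, symmetric])
        qed
      qed
      also have "\<dots> \<le> liminf (\<lambda>i. \<integral>\<^sup>+x. ennreal ((F n x - F (r i) x)\<^sup>2) \<partial>M)"
        by (rule nn_integral_liminf) simp
      also have "\<dots> \<le> ennreal (e\<^sup>2)"
      proof -
        have "(\<integral>\<^sup>+x. ennreal ((F n x - F (r i) x)\<^sup>2) \<partial>M) \<le> ennreal (e\<^sup>2)" if i: "i \<ge> N" for i
        proof -
          have "sqrt (\<integral>x. (F n x - F (r i) x)\<^sup>2 \<partial>M) < e"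
            using N[OF n, of "r i"] i strict_mono_imp_increasing[OF r(1), of i] by simp
          then have "(\<integral>x. (F n x - F (r i) x)\<^sup>2 \<partial>M) \<le> e\<^sup>2"
            by (intro sqrt_le_D less_imp_le)
          then show ?thesis
            using L2_square_integrable[OF diff[OF F F]] by (subst nn_integral_eq_integral) (auto intro: ennreal_leI)
        qed
        then have "\<forall>\<^sub>F i in sequentially. (\<integral>\<^sup>+x. ennreal ((F n x - F (r i) x)\<^sup>2) \<partial>M) \<le> ennreal (e\<^sup>2)"
          by (auto simp: eventually_sequentially)
        then show ?thesis
          using Liminf_mono[of _ "\<lambda>_. ennreal (e\<^sup>2)" sequentially] by (simp add: Liminf_const)
      qed
      finally have *: "(\<integral>\<^sup>+x. ennreal ((F n x - g x)\<^sup>2) \<partial>M) \<le> ennreal (e\<^sup>2)" .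
      have int: "integrable M (\<lambda>x. (F n x - g x)\<^sup>2)"
        by (rule integrableI_nonneg) (use * in \<open>auto simp: top.not_eq_extremum[symmetric] top_unique\<close>)
      moreover have "ennreal (\<integral>x. (F n x - g x)\<^sup>2 \<partial>M) \<le> ennreal (e\<^sup>2)"
        using * nn_integral_eq_integral[OF int] by simp
      ultimately show ?thesis by simp
    qed
    then show ?thesis by blast
  qed
  have "g \<in> L2 M"
  proof -
    obtain n where "integrable M (\<lambda>x. (F n x - g x)\<^sup>2)"
      using close[of 1] by auto
    then have "(\<lambda>x. F n x - g x) \<in> L2 M" by (simp add: L2_def)
    from diff[OF F[of n] this] show ?thesis by simp
  qed
  moreover have "(\<lambda>n. sqrt (L2_inner M (\<lambda>x. F n x - g x) (\<lambda>x. F n x - g x))) \<longlonglongrightarrow> 0"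
  proof (rule LIMSEQ_I)
    fix e :: real assume "0 < e"
    then obtain N where N: "\<And>n. n \<ge> N \<Longrightarrow> (\<integral>x. (F n x - g x)\<^sup>2 \<partial>M) \<le> (e/2)\<^sup>2"
      using close[of "e/2"] by auto
    have "sqrt (\<integral>x. (F n x - g x)\<^sup>2 \<partial>M) < e" if "n \<ge> N" for n
      using real_le_lsqrt[OF _ N[OF that]] \<open>0 < e\<close> by simp
    then show "\<exists>N. \<forall>n\<ge>N. norm (sqrt (L2_inner M (\<lambda>x. F n x - g x) (\<lambda>x. F n x - g x)) - 0) < e"
      unfolding ip_sq by auto
  qed
  ultimately show ?thesis by blast
qed

sublocale prob_space \<subseteq> L2: semi_hilbert "L2 M" "L2_inner M"
proof (unfold_locales, goal_cases)
  case 1 then show ?case by (rule L2_const)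
next
  case 2 then show ?case by (rule L2_add)
next
  case 3 then show ?case by (rule L2_scale)
next
  case 4 then show ?case by (simp add: L2_inner_def mult.commute)
next
  case 5 then show ?case by (simp add: L2_inner_def distrib_right L2_mult_integrable)
next
  case 6 then show ?case by (simp add: L2_inner_def mult.assoc)
next
  case 7 then show ?case by (simp add: L2_inner_def)
next
  case 8 then show ?case by (rule L2_complete)
qed

section \<open>Vanishing Fourier transforms\<close>

lemma iexp_lipschitz: "cmod (iexp a - iexp b) \<le> \<bar>a - b\<bar>"
proof -
  have "iexp a - iexp b = iexp b * (iexp (a - b) - 1)"
    by (simp add: algebra_simps flip: exp_add)
  then have "cmod (iexp a - iexp b) = cmod (iexp (a - b) - 1)"
    by (simp add: norm_mult)
  also have "\<dots> \<le> \<bar>a - b\<bar>" using iexp_approx1[of "a - b" 0] by simp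
  finally show ?thesis .
qed

lemma integrable_iexp_mult:
  fixes H :: "'a \<Rightarrow> complex"
  assumes H: "integrable M H" and Y [measurable]: "Y \<in> borel_measurable M"
  shows "integrable M (\<lambda>x. H x * iexp (Y x))"
proof (rule Bochner_Integration.integrable_bound[OF H])
  show "(\<lambda>x. H x * iexp (Y x)) \<in> borel_measurable M" using H by measurable
qed (simp add: norm_mult)

text \<open>The positive and negative parts of \<open>H\<close> have the same integral \<open>c\<close>. If \<open>c > 0\<close>, then, as
  densities divided by \<open>c\<close>, they give \<open>X\<close> two laws with the same characteristic function, and
  Levy's uniqueness theorem applies.\<close>
lemma integral_eq_zero_of_fourier_zero_real:
  fixes H X :: "'a \<Rightarrow> real" and g :: "real \<Rightarrow> real"
  assumes H [measurable]: "integrable M H" and X [measurable]: "X \<in> borel_measurable M"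
    and fourier: "\<And>\<theta>. (CLINT x|M. of_real (H x) * iexp (\<theta> * X x)) = 0"
    and g [measurable]: "g \<in> borel_measurable borel" and Hg: "integrable M (\<lambda>x. H x * g (X x))"
  shows "(\<integral>x. H x * g (X x) \<partial>M) = 0"
proof -
  define p where "p x = max (H x) 0" for x
  define q where "q x = max (- H x) 0" for x
  have pq: "H x = p x - q x" "0 \<le> p x" "0 \<le> q x" for x by (auto simp: p_def q_def)
  have p_int: "integrable M p" and q_int: "integrable M q"
    unfolding p_def q_def using H by auto
  have [measurable]: "p \<in> borel_measurable M" "q \<in> borel_measurable M"
    using p_int q_int by auto
  define c where "c = (\<integral>x. p x \<partial>M)"
  have "(CLINT x|M. of_real (H x)) = 0" using fourier[of 0] by simp
  then have "(\<integral>x. H x \<partial>M) = 0" by simp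
  then have c_q: "c = (\<integral>x. q x \<partial>M)" using p_int q_int by (simp add: pq(1) c_def)
  have c0: "0 \<le> c" unfolding c_def using pq by simp
  show ?thesis
  proof (cases "c = 0")
    case True
    have "AE x in M. p x = 0" "AE x in M. q x = 0"
      using True c_q integral_nonneg_eq_0_iff_AE[OF p_int] integral_nonneg_eq_0_iff_AE[OF q_int] pq
      by (auto simp: c_def)
    then have "AE x in M. H x * g (X x) = 0" by eventually_elim (simp add: pq(1))
    then show ?thesis by (rule integral_eq_zero_AE)
  next
    case False
    with c0 have c: "0 < c" by simp
    define law where "law h = distr (density M (\<lambda>x. ennreal (h x / c))) borel X" for h
    have law: "real_distribution (law h)" if [measurable]: "h \<in> borel_measurable M"
        and h: "integrable M h" "\<And>x. 0 \<le> h x" "(\<integral>x. h x \<partial>M) = c" for h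
    proof -
      have "(\<integral>\<^sup>+x. ennreal (h x / c) \<partial>M) = ennreal (\<integral>x. h x / c \<partial>M)"
        using h c by (intro nn_integral_eq_integral) auto
      also have "\<dots> = 1" using h c by simp
      finally have "prob_space (density M (\<lambda>x. ennreal (h x / c)))"
        by (intro prob_spaceI) (simp add: emeasure_density)
      then show ?thesis
        unfolding law_def by (intro prob_space.real_distribution_distr) auto
    qed
    have law_char: "char (law h) \<theta> = (CLINT x|M. of_real (h x) * iexp (\<theta> * X x)) / of_real c"
      if [measurable]: "h \<in> borel_measurable M" and h: "\<And>x. 0 \<le> h x" for h \<theta>
    proof -
      have "char (law h) \<theta> = (CLINT x|M. (h x / c) *\<^sub>R iexp (\<theta> * X x))"
        unfolding law_def char_def using h c by (simp add: integral_distr integral_density)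
      also have "\<dots> = (CLINT x|M. of_real (h x) * iexp (\<theta> * X x) / of_real c)"
        by (intro Bochner_Integration.integral_cong) (auto simp: scaleR_conv_of_real)
      finally show ?thesis by simp
    qed
    have "law p = law q"
    proof (rule Levy_uniqueness)
      show "real_distribution (law p)" "real_distribution (law q)"
        using p_int q_int pq c_q by (auto intro!: law simp: c_def)
      show "char (law p) = char (law q)"
      proof
        fix \<theta>
        have int: "integrable M (\<lambda>x. complex_of_real (p x) * iexp (\<theta> * X x))"
          "integrable M (\<lambda>x. complex_of_real (q x) * iexp (\<theta> * X x))"
          using p_int q_int by (intro integrable_iexp_mult; simp)+
        have "0 = (CLINT x|M. of_real (p x) * iexp (\<theta> * X x) - of_real (q x) * iexp (\<theta> * X x))"
          using fourier[of \<theta>] by (simp add: pq(1) left_diff_distrib)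
        also have "\<dots> = (CLINT x|M. of_real (p x) * iexp (\<theta> * X x)) - (CLINT x|M. of_real (q x) * iexp (\<theta> * X x))"
          using int by (rule Bochner_Integration.integral_diff)
        finally show "char (law p) \<theta> = char (law q) \<theta>"
          using pq by (simp add: law_char)
      qed
    qed
    have law_integral: "(\<integral>y. g y \<partial>law h) = (\<integral>x. h x * g (X x) \<partial>M) / c"
      if [measurable]: "h \<in> borel_measurable M" and h: "\<And>x. 0 \<le> h x" for h
      unfolding law_def using h c by (simp add: integral_distr integral_density)
    have "(\<integral>x. p x * g (X x) \<partial>M) = (\<integral>x. q x * g (X x) \<partial>M)"
      using law_integral[of p] law_integral[of q] \<open>law p = law q\<close> pq c by simp
    moreover have "integrable M (\<lambda>x. p x * g (X x))"
      by (rule Bochner_Integration.integrable_bound[OF Hg]) (auto simp: p_def abs_mult intro!: mult_right_mono)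
    moreover have "integrable M (\<lambda>x. q x * g (X x))"
      by (rule Bochner_Integration.integrable_bound[OF Hg]) (auto simp: q_def abs_mult intro!: mult_right_mono)
    ultimately show ?thesis by (simp add: pq(1) left_diff_distrib)
  qed
qed

text \<open>The real and imaginary parts of \<open>H\<close> can be treated separately: conjugation replaces \<open>\<theta>\<close> by \<open>-\<theta>\<close>, so
  the transform of the conjugate of \<open>H\<close> vanishes as well.\<close>
lemma integral_eq_zero_of_fourier_zero:
  fixes H :: "'a \<Rightarrow> complex" and X :: "'a \<Rightarrow> real"
  assumes H [measurable]: "integrable M H" and X [measurable]: "X \<in> borel_measurable M"
    and fourier: "\<And>\<theta>. (CLINT x|M. H x * iexp (\<theta> * X x)) = 0"
    and B [measurable]: "B \<in> sets borel"
  shows "(CLINT x|M. H x * of_real (indicator B (X x))) = 0"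
proof -
  have cnj_fourier: "(CLINT x|M. cnj (H x) * iexp (\<theta> * X x)) = 0" for \<theta>
  proof -
    have "(CLINT x|M. cnj (H x) * iexp (\<theta> * X x)) = (CLINT x|M. cnj (H x * iexp ((-\<theta>) * X x)))"
      by (intro Bochner_Integration.integral_cong) (auto simp: exp_cnj)
    also have "\<dots> = 0" using fourier[of "-\<theta>"] by (subst Bochner_Integration.integral_cnj) simp
    finally show ?thesis .
  qed
  have intH: "integrable M (\<lambda>x. H x * iexp (\<theta> * X x))" for \<theta>
    using H by (rule integrable_iexp_mult) simp
  have intC: "integrable M (\<lambda>x. cnj (H x) * iexp (\<theta> * X x))" for \<theta>
    by (rule integrable_iexp_mult) (use H in auto)
  have ind: "integrable M (\<lambda>x. h x * indicator B (X x))" if "integrable M h" for h :: "'a \<Rightarrow> real"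
    by (rule Bochner_Integration.integrable_bound[OF that]) (use that in \<open>auto simp: indicator_def\<close>)
  have Re: "(\<integral>x. Re (H x) * indicator B (X x) \<partial>M) = 0"
  proof (rule integral_eq_zero_of_fourier_zero_real[where X = X and g = "indicator B"])
    fix \<theta>
    have "(CLINT x|M. of_real (Re (H x)) * iexp (\<theta> * X x))
        = (CLINT x|M. (H x * iexp (\<theta> * X x) + cnj (H x) * iexp (\<theta> * X x)) / 2)"
      by (intro Bochner_Integration.integral_cong) (auto simp: complex_add_cnj distrib_right[symmetric])
    also have "\<dots> = 0" using intH intC fourier cnj_fourier by simp
    finally show "(CLINT x|M. of_real (Re (H x)) * iexp (\<theta> * X x)) = 0" .
  qed (use H in \<open>auto intro!: ind\<close>)
  have Im_eq: "complex_of_real (Im z) = (z - cnj z) / (2 * \<i>)" for z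
    by (simp add: complex_diff_cnj) (simp add: complex_eq_iff)
  have Im: "(\<integral>x. Im (H x) * indicator B (X x) \<partial>M) = 0"
  proof (rule integral_eq_zero_of_fourier_zero_real[where X = X and g = "indicator B"])
    fix \<theta>
    have "(CLINT x|M. of_real (Im (H x)) * iexp (\<theta> * X x))
        = (CLINT x|M. (H x * iexp (\<theta> * X x) - cnj (H x) * iexp (\<theta> * X x)) / (2 * \<i>))"
      unfolding Im_eq by (simp only: times_divide_eq_left left_diff_distrib)
    also have "\<dots> = 0" using intH intC fourier cnj_fourier by simp
    finally show "(CLINT x|M. of_real (Im (H x)) * iexp (\<theta> * X x)) = 0" .
  qed (use H in \<open>auto intro!: ind\<close>)
  have int: "integrable M (\<lambda>x. H x * of_real (indicator B (X x)))"
    by (rule Bochner_Integration.integrable_bound[OF H]) (auto simp: norm_mult indicator_def)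
  show ?thesis
    using Re Im int by (intro complex_eqI) (simp_all flip: integral_Re integral_Im)
qed

text \<open>A finite-dimensional uniqueness theorem obtained by exchanging one exponential factor at a time for
  an indicator. The remaining exponentials are absorbed into the weight, which is the reason for
  admitting complex weights.\<close>
lemma integral_eq_zero_of_multivariate_fourier_zero:
  fixes H :: "'a \<Rightarrow> complex" and X :: "'i \<Rightarrow> 'a \<Rightarrow> real"
  assumes F: "finite F" and H: "integrable M H"
    and X: "\<And>u. u \<in> F \<Longrightarrow> X u \<in> borel_measurable M"
    and fourier: "\<And>\<theta>. (CLINT x|M. H x * iexp (\<Sum>u\<in>F. \<theta> u * X u x)) = 0"
    and B: "\<And>u. u \<in> F \<Longrightarrow> B u \<in> sets borel"
  shows "(CLINT x|M. H x * of_real (\<Prod>u\<in>F. indicator (B u) (X u x))) = 0"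
  using assms
proof (induction F arbitrary: H)
  case empty
  then show ?case by simp
next
  case (insert v F)
  have [measurable]: "X v \<in> borel_measurable M" "B v \<in> sets borel" using insert by auto
  have [measurable]: "H \<in> borel_measurable M" using insert by auto
  have XF [measurable]: "(\<lambda>x. \<Sum>u\<in>F. \<theta> u * X u x) \<in> borel_measurable M" for \<theta>
    using insert.prems(2) by (intro borel_measurable_sum borel_measurable_times) auto
  have step: "(CLINT x|M. (H x * of_real (indicator (B v) (X v x))) * iexp (\<Sum>u\<in>F. \<theta> u * X u x)) = 0" for \<theta>
  proof -
    have "(CLINT x|M. (H x * iexp (\<Sum>u\<in>F. \<theta> u * X u x)) * of_real (indicator (B v) (X v x))) = 0"
    proof (rule integral_eq_zero_of_fourier_zero)
      show "integrable M (\<lambda>x. H x * iexp (\<Sum>u\<in>F. \<theta> u * X u x))"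
        using insert.prems(1) XF by (rule integrable_iexp_mult)
      fix \<tau>
      have "(\<Sum>u\<in>insert v F. (\<theta>(v := \<tau>)) u * X u x) = \<tau> * X v x + (\<Sum>u\<in>F. \<theta> u * X u x)" for x
      proof -
        have "(\<Sum>u\<in>F. (\<theta>(v := \<tau>)) u * X u x) = (\<Sum>u\<in>F. \<theta> u * X u x)"
          using insert.hyps by (intro sum.cong) auto
        then show ?thesis using insert.hyps by simp
      qed
      then have "(CLINT x|M. H x * iexp (\<tau> * X v x + (\<Sum>u\<in>F. \<theta> u * X u x))) = 0"
        using insert.prems(3)[of "\<theta>(v := \<tau>)"] by simp
      then show "(CLINT x|M. H x * iexp (\<Sum>u\<in>F. \<theta> u * X u x) * iexp (\<tau> * X v x)) = 0"
        by (simp add: distrib_left exp_add mult_ac)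
    qed auto
    then show ?thesis by (simp add: mult_ac)
  qed
  have int: "integrable M (\<lambda>x. H x * of_real (indicator (B v) (X v x)))"
    by (rule Bochner_Integration.integrable_bound[OF insert.prems(1)]) (auto simp: norm_mult indicator_def)
  have "(CLINT x|M. (H x * of_real (indicator (B v) (X v x))) * of_real (\<Prod>u\<in>F. indicator (B u) (X u x))) = 0"
    using insert.IH[OF int _ step] insert.prems by simp
  then show ?case using insert.hyps by (simp add: mult_ac)
qed

section \<open>The sigma-algebra generated by part of a process\<close>

lemma subalgebra_sigma_of:
  assumes "\<And>u. u \<in> J \<Longrightarrow> X u \<in> borel_measurable M"
  shows "subalgebra M (sigma_of M X J)"
proof -
  have "(\<lambda>\<omega>. \<lambda>u\<in>J. X u \<omega>) \<in> measurable M (\<Pi>\<^sub>M u\<in>J. (borel :: real measure))"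
    using assms by (rule measurable_restrict)
  then show ?thesis
    unfolding subalgebra_def sigma_of_def by (simp add: sets_image_in_sets)
qed

lemma measurable_sigma_of:
  assumes u: "u \<in> J"
  shows "X u \<in> borel_measurable (sigma_of M X J)"
proof -
  have "(\<lambda>\<omega>. \<lambda>u\<in>J. X u \<omega>) \<in> measurable (sigma_of M X J) (\<Pi>\<^sub>M u\<in>J. (borel :: real measure))"
    unfolding sigma_of_def by (rule measurable_vimage_algebra1) (simp add: space_PiM)
  from measurable_compose[OF this measurable_component_singleton[OF u]]
  show ?thesis using u by simp
qed

text \<open>Dynkin's argument: the finite-dimensional cylinders are an intersection-stable generator. The empty
  cylinder says that \<open>H\<close> itself has integral \<open>0\<close>, which handles complements.\<close>
lemma set_integral_sigma_of_eq_zero: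
  fixes H :: "'a \<Rightarrow> complex"
  assumes H: "integrable M H" and X: "\<And>u. u \<in> J \<Longrightarrow> X u \<in> borel_measurable M"
    and cylinder: "\<And>F B. finite F \<Longrightarrow> F \<subseteq> J \<Longrightarrow> (\<And>u. u \<in> F \<Longrightarrow> B u \<in> sets borel) \<Longrightarrow>
      (CLINT x|M. H x * of_real (\<Prod>u\<in>F. indicator (B u) (X u x))) = 0"
    and A: "A \<in> sets (sigma_of M X J)"
  shows "(CLINT x:A|M. H x) = 0"
proof -
  define f where "f \<omega> = (\<lambda>u\<in>J. X u \<omega>)" for \<omega>
  let ?P = "\<Pi>\<^sub>M u\<in>J. (borel :: real measure)"
  have f: "f \<in> measurable M ?P"
    unfolding f_def using X by (rule measurable_restrict)
  have f_sp: "f \<in> space M \<rightarrow> space ?P"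
    by (auto simp: f_def space_PiM)
  obtain B where B: "B \<in> sets ?P" "A = f -` B \<inter> space M"
    using A unfolding sigma_of_def f_def[symmetric] sets_vimage_algebra2[OF f_sp] by blast
  have sets_P: "sigma_sets (\<Pi>\<^sub>E i\<in>J. space borel) (prod_algebra J (\<lambda>_. borel :: real measure)) = sets ?P"
    by (rule sets_PiM[symmetric])
  have pre: "f -` C \<inter> space M \<in> sets M" if "C \<in> sets ?P" for C
    using measurable_sets[OF f that] .
  have setint: "set_integrable M C H" if "C \<in> sets M" for C
    unfolding set_integrable_def using integrable_mult_indicator[OF that H] .
  have H0: "(CLINT x|M. H x) = 0" using cylinder[of "{}"] by simp
  have "(CLINT x:(f -` B \<inter> space M)|M. H x) = 0"
    using Int_stable_prod_algebra prod_algebra_sets_into_space B(1)[folded sets_P]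
  proof (induction B rule: sigma_sets_induct_disjoint)
    case (basic C)
    obtain F E where C: "C = prod_emb J (\<lambda>_. borel) F (\<Pi>\<^sub>E j\<in>F. E j)"
      "finite F" "F \<subseteq> J" "\<And>i. i \<in> F \<Longrightarrow> E i \<in> sets (borel :: real measure)"
      using prod_algebraE[OF basic] by metis
    have iff: "f x \<in> C \<longleftrightarrow> (\<forall>u\<in>F. X u x \<in> E u)" for x
      using C(3) by (auto simp: C(1) f_def prod_emb_def PiE_iff Int_absorb1 restrict_def extensional_def split: if_splits)
    have "(CLINT x:(f -` C \<inter> space M)|M. H x) = (CLINT x|M. H x * of_real (\<Prod>u\<in>F. indicator (E u) (X u x)))"
      unfolding set_lebesgue_integral_def
    proof (rule Bochner_Integration.integral_cong[OF refl])
      fix x assume x: "x \<in> space M"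
      have "(\<Prod>u\<in>F. indicator (E u) (X u x) :: real) = indicator (f -` C \<inter> space M) x"
      proof (cases "\<forall>u\<in>F. X u x \<in> E u")
        case True
        then show ?thesis using iff[of x] x by simp
      next
        case False
        then obtain u where "u \<in> F" "X u x \<notin> E u" by blast
        then have "(\<Prod>u\<in>F. indicator (E u) (X u x) :: real) = 0"
          using C(2) by (intro prod_zero bexI[of _ u]) auto
        then show ?thesis using False iff[of x] by simp
      qed
      then show "indicat_real (f -` C \<inter> space M) x *\<^sub>R H x = H x * of_real (\<Prod>u\<in>F. indicator (E u) (X u x))"
        by (simp add: scaleR_conv_of_real mult.commute)
    qed
    also have "\<dots> = 0" using C by (intro cylinder) auto
    finally show ?case .
  next
    case empty
    then show ?case by (simp add: set_lebesgue_integral_def)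
  next
    case (compl C)
    have [measurable]: "f -` C \<inter> space M \<in> sets M" using compl sets_P by (intro pre) simp
    have "(CLINT x:(f -` ((\<Pi>\<^sub>E i\<in>J. space borel) - C) \<inter> space M)|M. H x)
        = (CLINT x|M. H x - indicat_real (f -` C \<inter> space M) x *\<^sub>R H x)"
      unfolding set_lebesgue_integral_def
      by (rule Bochner_Integration.integral_cong[OF refl]) (auto simp: indicator_def f_def)
    also have "\<dots> = (CLINT x|M. H x) - (CLINT x:(f -` C \<inter> space M)|M. H x)"
      unfolding set_lebesgue_integral_def
      by (intro Bochner_Integration.integral_diff H integrable_mult_indicator) simp
    finally show ?case using compl H0 by simp
  next
    case (union C)
    have C: "C i \<in> sets ?P" for i using union(2) sets_P by auto
    have eq: "f -` (\<Union>i. C i) \<inter> space M = (\<Union>i. f -` C i \<inter> space M)" by auto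
    have "(CLINT x:(\<Union>i. f -` C i \<inter> space M)|M. H x) = (\<Sum>i. CLINT x:(f -` C i \<inter> space M)|M. H x)"
    proof (rule lebesgue_integral_countable_add)
      show "f -` C i \<inter> space M \<in> sets M" for i using C by (rule pre)
      then show "set_integrable M (\<Union>i. f -` C i \<inter> space M) H" by (intro setint sets.countable_UN) blast
      show "(f -` C i \<inter> space M) \<inter> (f -` C j \<inter> space M) = {}" if "i \<noteq> j" for i j
        using disjoint_family_onD[OF union(1) _ _ that] by auto
    qed
    then show ?case unfolding eq using union(3) by simp
  qed
  then show ?thesis using B(2) by simp
qed

section \<open>Gaussian spaces\<close>

context prob_space
begin

lemma gaussian_rv_L2_char:
  assumes Y: "gaussian_rv M Y"
  shows "Y \<in> L2 M"
    and "(CLINT \<omega>|M. iexp (Y \<omega> - expectation Y)) = of_real (exp (- variance Y / 2))"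
proof -
  have [measurable]: "Y \<in> borel_measurable M" using Y by (simp add: gaussian_rv_def)
  have "Y \<in> L2 M \<and> (CLINT \<omega>|M. iexp (Y \<omega> - expectation Y)) = of_real (exp (- variance Y / 2))"
  proof (cases "\<exists>\<mu>. AE \<omega> in M. Y \<omega> = \<mu>")
    case True
    then obtain \<mu> where \<mu>: "AE \<omega> in M. Y \<omega> = \<mu>" by blast
    have "integrable M (\<lambda>\<omega>. (Y \<omega>)\<^sup>2) \<longleftrightarrow> integrable M (\<lambda>\<omega>. \<mu>\<^sup>2)"
      by (intro integrable_cong_AE) (use \<mu> in auto)
    then have L2: "Y \<in> L2 M" by (simp add: L2_def)
    have E: "expectation Y = \<mu>"
      using \<mu> integral_cong_AE[of Y M "\<lambda>_. \<mu>"] by (simp add: prob_space)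
    have "variance Y = (\<integral>\<omega>. 0 \<partial>M)"
      unfolding E by (intro integral_cong_AE) (use \<mu> in auto)
    moreover have "(CLINT \<omega>|M. iexp (Y \<omega> - expectation Y)) = (CLINT \<omega>|M. 1)"
      unfolding E by (intro integral_cong_AE) (use \<mu> in auto)
    ultimately show ?thesis using L2 by (simp add: prob_space)
  next
    case False
    then obtain \<mu> \<sigma> where \<sigma>: "0 < \<sigma>" and Yd: "distributed M lborel Y (normal_density \<mu> \<sigma>)"
      using Y unfolding gaussian_rv_def by blast
    have E: "expectation Y = \<mu>" using \<sigma> Yd by (rule normal_distributed_expectation)
    have V: "variance Y = \<sigma>\<^sup>2" using \<sigma> Yd by (rule normal_distributed_variance)
    have "integrable M (\<lambda>\<omega>. (Y \<omega> - \<mu>)\<^sup>2)"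
      using distributed_integrable[OF Yd, of "\<lambda>y. (y - \<mu>)\<^sup>2"] integrable_normal_moment[where \<mu> = \<mu> and \<sigma> = \<sigma> and k = 2] \<sigma> by simp
    then have "(\<lambda>\<omega>. Y \<omega> - \<mu>) \<in> L2 M" by (simp add: L2_def)
    from L2_add[OF this L2_const[of \<mu>]] have L2: "Y \<in> L2 M" by simp
    define Z where "Z \<omega> = (Y \<omega> - \<mu>) / \<sigma>" for \<omega>
    have [measurable]: "Z \<in> borel_measurable M" unfolding Z_def by measurable
    have "distributed M lborel Z std_normal_density"
      using normal_standard_normal_convert[OF \<sigma>] Yd unfolding Z_def by blast
    then have law: "distr M borel Z = std_normal_distribution"
      using distributed_distr_eq_density[of M lborel Z std_normal_density] by (metis distr_cong sets_lborel)
    have "(CLINT \<omega>|M. iexp (Y \<omega> - expectation Y)) = (CLINT \<omega>|M. iexp (\<sigma> * Z \<omega>))"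
      unfolding E Z_def using \<sigma> by (intro Bochner_Integration.integral_cong) auto
    also have "\<dots> = char (distr M borel Z) \<sigma>"
      unfolding char_def by (subst integral_distr) auto
    also have "\<dots> = of_real (exp (- variance Y / 2))"
      unfolding law char_std_normal_distribution V by simp
    finally show ?thesis using L2 by blast
  qed
  then show "Y \<in> L2 M"
    "(CLINT \<omega>|M. iexp (Y \<omega> - expectation Y)) = of_real (exp (- variance Y / 2))" by blast+
qed

text \<open>The transform is prescribed at the frequency \<open>1\<close> only. On a linear space contained in this set
  that determines it at every frequency, so such a space consists of centred normal variables.\<close>
definition centred_gaussian :: "('a \<Rightarrow> real) set" where
  "centred_gaussian = {Y \<in> L2 M. (CLINT \<omega>|M. iexp (Y \<omega>)) = of_real (exp (- L2_inner M Y Y / 2))}"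

lemma integrable_iexp_real:
  "Y \<in> borel_measurable M \<Longrightarrow> integrable M (\<lambda>\<omega>. iexp (Y \<omega>))"
  using integrable_iexp_mult[of M "\<lambda>_. 1" Y] by simp

text \<open>Both sides of the defining equation are continuous in the \<open>L\<^sup>2\<close>-norm, the left one because
  \<open>exp(\<i>x)\<close> is Lipschitz in \<open>x\<close> and the \<open>L\<^sup>1\<close>-norm is at most the \<open>L\<^sup>2\<close>-norm.\<close>
lemma clos_centred_gaussian: "L2.clos centred_gaussian \<subseteq> centred_gaussian"
proof
  fix Y assume Y: "Y \<in> L2.clos centred_gaussian"
  then obtain Z where Z: "\<And>n. Z n \<in> centred_gaussian" "(\<lambda>n::nat. L2.nrm (\<lambda>x. Z n x - Y x)) \<longlonglongrightarrow> 0"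
    unfolding L2.clos_def by blast
  have YL: "Y \<in> L2 M" using Y by (rule L2.clos_mem)
  have ZL: "Z n \<in> L2 M" for n using Z(1)[of n] by (simp add: centred_gaussian_def)
  have [measurable]: "Y \<in> borel_measurable M" "Z n \<in> borel_measurable M" for n
    using YL ZL by (auto intro: L2_measurable)
  have "(\<lambda>n. CLINT \<omega>|M. iexp (Z n \<omega>)) \<longlonglongrightarrow> (CLINT \<omega>|M. iexp (Y \<omega>))"
  proof -
    have bound: "cmod ((CLINT \<omega>|M. iexp (Z n \<omega>)) - (CLINT \<omega>|M. iexp (Y \<omega>))) \<le> L2.nrm (\<lambda>x. Z n x - Y x)" for n
    proof -
      have d: "(\<lambda>x. Z n x - Y x) \<in> L2 M" using ZL YL by simp
      have "(CLINT \<omega>|M. iexp (Z n \<omega>)) - (CLINT \<omega>|M. iexp (Y \<omega>)) = (CLINT \<omega>|M. iexp (Z n \<omega>) - iexp (Y \<omega>))"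
        by (intro Bochner_Integration.integral_diff[symmetric] integrable_iexp_real) auto
      also have "cmod \<dots> \<le> (\<integral>\<omega>. \<bar>Z n \<omega> - Y \<omega>\<bar> \<partial>M)"
        using iexp_lipschitz L2_integrable[OF d]
        by (intro order_trans[OF integral_norm_bound] integral_mono integrable_norm
            Bochner_Integration.integrable_diff integrable_iexp_real) auto
      also have "\<dots> \<le> L2.nrm (\<lambda>x. Z n x - Y x)"
        unfolding L2.nrm_def by (rule L1_le_L2[OF d])
      finally show ?thesis .
    qed
    have "(\<lambda>n. (CLINT \<omega>|M. iexp (Z n \<omega>)) - (CLINT \<omega>|M. iexp (Y \<omega>))) \<longlonglongrightarrow> 0"
      by (rule Lim_null_comparison[OF _ Z(2)]) (use bound in auto)
    then show ?thesis by (simp add: LIM_zero_iff)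
  qed
  moreover have "(\<lambda>n. CLINT \<omega>|M. iexp (Z n \<omega>)) \<longlonglongrightarrow> of_real (exp (- L2_inner M Y Y / 2))"
  proof -
    have "(\<lambda>n. complex_of_real (exp (- (L2.nrm (Z n))\<^sup>2 / 2))) \<longlonglongrightarrow> of_real (exp (- (L2.nrm Y)\<^sup>2 / 2))"
      by (intro tendsto_intros L2.nrm_tendsto[OF ZL YL Z(2)]) auto
    then show ?thesis using Z(1) ZL YL by (simp add: L2.nrm_square centred_gaussian_def)
  qed
  ultimately have "(CLINT \<omega>|M. iexp (Y \<omega>)) = of_real (exp (- L2_inner M Y Y / 2))"
    by (rule LIMSEQ_unique)
  then show "Y \<in> centred_gaussian" using YL by (simp add: centred_gaussian_def)
qed

end

locale gaussian_family = prob_space M for M :: "'a measure" +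
  fixes I :: "real set" and X :: "real \<Rightarrow> 'a \<Rightarrow> real"
  assumes gaussian: "gaussian_process M I X"
begin

definition D :: "real \<Rightarrow> 'a \<Rightarrow> real" where "D u \<omega> = X u \<omega> - expectation (X u)"

lemma X_L2: "u \<in> I \<Longrightarrow> X u \<in> L2 M"
  using gaussian[unfolded gaussian_process_def, rule_format, of "{u}" "\<lambda>_. 1"]
  by (intro gaussian_rv_L2_char(1)) simp

lemma D_L2: "u \<in> I \<Longrightarrow> D u \<in> L2 M"
  unfolding D_def using L2_add[OF X_L2 L2_const[of "- expectation (X u)"]] by simp

lemma expectation_D: "u \<in> I \<Longrightarrow> expectation (D u) = 0"
  unfolding D_def using L2_integrable[OF X_L2] by (simp add: prob_space)

abbreviation closed_span :: "real set \<Rightarrow> ('a \<Rightarrow> real) set" where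
  "closed_span J \<equiv> L2.clos (lin_span D J)"

lemma lin_span_D_L2: "J \<subseteq> I \<Longrightarrow> lin_span D J \<subseteq> L2 M"
  using L2.lin_span_mem[of J D] D_L2 by blast

lemma closed_span_mono: "J \<subseteq> I \<Longrightarrow> closed_span J \<subseteq> closed_span I"
  by (intro L2.clos_mono lin_span_mono)

lemma closed_span_add:
  "V \<in> closed_span I \<Longrightarrow> W \<in> closed_span I \<Longrightarrow> (\<lambda>x. V x + W x) \<in> closed_span I"
  by (intro L2.clos_add lin_span_D_L2 lin_span_add order_refl)

lemma closed_span_scale: "V \<in> closed_span I \<Longrightarrow> (\<lambda>x. c * V x) \<in> closed_span I"
  by (intro L2.clos_scale lin_span_D_L2 lin_span_scale order_refl)

lemma closed_span_diff:
  "V \<in> closed_span I \<Longrightarrow> W \<in> closed_span I \<Longrightarrow> (\<lambda>x. V x - W x) \<in> closed_span I"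
  using closed_span_add[OF _ closed_span_scale[of W "-1"]] by simp

lemma D_closed_span: "u \<in> J \<Longrightarrow> J \<subseteq> I \<Longrightarrow> D u \<in> closed_span J"
  by (intro L2.clos_base lin_span_D_L2 lin_span_base)

lemma closed_span_L2: "V \<in> closed_span J \<Longrightarrow> V \<in> L2 M"
  by (rule L2.clos_mem)

lemma expectation_closed_span:
  assumes "V \<in> closed_span I"
  shows "expectation V = 0"
proof -
  have "L2_inner M V (\<lambda>x. 1) = 0"
  proof (rule L2.closed_span_orthogonal[OF D_L2 L2_const _ assms])
    show "L2_inner M (D u) (\<lambda>x. 1) = 0" if "u \<in> I" for u
      using expectation_D[OF that] by (simp add: L2_inner_def)
  qed
  then show ?thesis by (simp add: L2_inner_def)
qed

lemma closed_span_centred_gaussian: "closed_span I \<subseteq> centred_gaussian"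
proof -
  have "lin_span D I \<subseteq> centred_gaussian"
  proof
    fix Y assume Y: "Y \<in> lin_span D I"
    then obtain F c where F: "finite F" "F \<subseteq> I" "Y = (\<lambda>x. \<Sum>u\<in>F. c u * D u x)"
      using lin_spanE by metis
    define Z where "Z \<omega> = (\<Sum>u\<in>F. c u * X u \<omega>)" for \<omega>
    have Z: "gaussian_rv M Z"
      unfolding Z_def using gaussian F(1,2) unfolding gaussian_process_def by blast
    have "expectation Z = (\<Sum>u\<in>F. c u * expectation (X u))"
      unfolding Z_def using F(2) L2_integrable[OF X_L2] by (subst Bochner_Integration.integral_sum) auto
    then have YZ: "Y \<omega> = Z \<omega> - expectation Z" for \<omega>
      by (simp add: F(3) Z_def D_def right_diff_distrib sum_subtractf)
    have "Y \<in> L2 M" using lin_span_D_L2 Y by blast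
    moreover have "L2_inner M Y Y = variance Z"
      unfolding L2_inner_def YZ by (simp add: power2_eq_square)
    ultimately show "Y \<in> centred_gaussian"
      using gaussian_rv_L2_char(2)[OF Z] by (simp add: centred_gaussian_def YZ)
  qed
  then show ?thesis using L2.clos_mono clos_centred_gaussian by blast
qed

text \<open>The sum in the exponent is a constant plus an element \<open>W\<close> of the span over \<open>J\<close>. As \<open>V\<close> and \<open>W\<close> are
  orthogonal, Pythagoras gives \<open>\<parallel>V + W\<parallel>\<^sup>2 = \<parallel>V\<parallel>\<^sup>2 + \<parallel>W\<parallel>\<^sup>2\<close>, and the characteristic function of
  \<open>V + W\<close> factorizes.\<close>
lemma iexp_orthogonal:
  assumes J: "J \<subseteq> I" and V: "V \<in> closed_span I" and orth: "\<And>u. u \<in> J \<Longrightarrow> L2_inner M (D u) V = 0"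
    and F: "finite F" "F \<subseteq> J"
  shows "(CLINT \<omega>|M. (iexp (V \<omega>) - (CLINT \<omega>'|M. iexp (V \<omega>'))) * iexp (\<Sum>u\<in>F. \<theta> u * X u \<omega>)) = 0"
proof -
  define W where "W \<omega> = (\<Sum>u\<in>F. \<theta> u * D u \<omega>)" for \<omega>
  define m where "m = (\<Sum>u\<in>F. \<theta> u * expectation (X u))"
  define c where "c = (CLINT \<omega>|M. iexp (V \<omega>))"
  have X_sum: "(\<Sum>u\<in>F. \<theta> u * X u \<omega>) = m + W \<omega>" for \<omega>
    by (simp add: W_def m_def D_def right_diff_distrib sum_subtractf)
  have "W \<in> lin_span D I"
    unfolding W_def using lin_spanI[OF F(1), of I] F J by auto
  then have W: "W \<in> closed_span I"
    by (intro L2.clos_base lin_span_D_L2 order_refl)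
  have VL: "V \<in> L2 M" and WL: "W \<in> L2 M" using V W closed_span_L2 by auto
  have [measurable]: "V \<in> borel_measurable M" "W \<in> borel_measurable M"
    using VL WL by (auto intro: L2_measurable)
  have "L2_inner M W V = (\<Sum>u\<in>F. \<theta> u * L2_inner M (D u) V)"
    using F J VL D_L2 by (intro L2.ip_lin_comb[of F J]) (auto simp: W_def)
  also have "\<dots> = 0" using orth F by (intro sum.neutral) auto
  finally have WV: "L2_inner M W V = 0" .
  have gauss: "(CLINT \<omega>|M. iexp (Y \<omega>)) = of_real (exp (- L2_inner M Y Y / 2))" if "Y \<in> closed_span I" for Y
    using closed_span_centred_gaussian that by (auto simp: centred_gaussian_def)
  have "(CLINT \<omega>|M. iexp (V \<omega> + W \<omega>)) = of_real (exp (- (L2_inner M V V + L2_inner M W W) / 2))"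
    using gauss[OF closed_span_add[OF V W]] VL WL WV
    by (simp add: L2.ip_bilinear L2.ip_commute[of V W])
  also have "\<dots> = c * (CLINT \<omega>|M. iexp (W \<omega>))"
    unfolding c_def gauss[OF V] gauss[OF W] by (simp add: add_divide_distrib flip: exp_add of_real_mult)
  finally have factor: "(CLINT \<omega>|M. iexp (V \<omega> + W \<omega>)) = c * (CLINT \<omega>|M. iexp (W \<omega>))" .
  have "(CLINT \<omega>|M. (iexp (V \<omega>) - c) * iexp (\<Sum>u\<in>F. \<theta> u * X u \<omega>))
      = (CLINT \<omega>|M. iexp m * (iexp (V \<omega> + W \<omega>) - c * iexp (W \<omega>)))"
    unfolding X_sum by (intro Bochner_Integration.integral_cong) (auto simp: algebra_simps exp_add)
  also have "\<dots> = iexp m * (CLINT \<omega>|M. iexp (V \<omega> + W \<omega>) - c * iexp (W \<omega>))"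
    by (rule integral_mult_right_zero)
  also have "(CLINT \<omega>|M. iexp (V \<omega> + W \<omega>) - c * iexp (W \<omega>)) = (CLINT \<omega>|M. iexp (V \<omega> + W \<omega>)) - c * (CLINT \<omega>|M. iexp (W \<omega>))"
    by (subst Bochner_Integration.integral_diff) (auto intro!: integrable_iexp_real integrable_mult_right simp del: of_real_add)
  finally show ?thesis using factor unfolding c_def by simp
qed

text \<open>Uniqueness of Fourier transforms is used twice. In the variables \<open>X\<^sub>u\<close> with \<open>u \<in> J\<close> it shows that the
  centred variable \<open>exp(\<i>\<theta>V) - E[exp(\<i>\<theta>V)]\<close> has integral \<open>0\<close> over \<open>A\<close>, for every frequency \<open>\<theta>\<close>. In the
  variable \<open>V\<close>, with the weight \<open>indicator A - prob A\<close>, it then gives the claim for every \<open>g\<close>.\<close>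
lemma orthogonal_imp_independent:
  assumes J: "J \<subseteq> I" and V: "V \<in> closed_span I" and orth: "\<And>u. u \<in> J \<Longrightarrow> L2_inner M (D u) V = 0"
    and A: "A \<in> sets (sigma_of M X J)"
    and g [measurable]: "g \<in> borel_measurable borel" and gV: "integrable M (\<lambda>\<omega>. g (V \<omega>))"
  shows "(\<integral>\<omega>. indicator A \<omega> * g (V \<omega>) \<partial>M) = prob A * (\<integral>\<omega>. g (V \<omega>) \<partial>M)"
proof -
  have XJ: "X u \<in> borel_measurable M" if "u \<in> J" for u
    using that J X_L2 L2_measurable by blast
  have [measurable]: "A \<in> sets M"
    using A subalgebra_sigma_of[of J X M] XJ unfolding subalgebra_def by blast
  have VL: "V \<in> L2 M" using V closed_span_L2 by blast
  have [measurable]: "V \<in> borel_measurable M" using VL by (rule L2_measurable)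
  have intA: "integrable M (\<lambda>\<omega>. indicator A \<omega> * f \<omega>)" if "integrable M f" for f :: "'a \<Rightarrow> real"
    using integrable_mult_indicator[OF _ that, of A] by simp
  have "(\<integral>\<omega>. (indicator A \<omega> - prob A) * g (V \<omega>) \<partial>M) = 0"
  proof (rule integral_eq_zero_of_fourier_zero_real[where X = V and g = g])
    show "integrable M (\<lambda>\<omega>. indicator A \<omega> - prob A)"
      by (intro Bochner_Integration.integrable_diff integrable_real_indicator) (auto simp: emeasure_eq_measure)
    show "integrable M (\<lambda>\<omega>. (indicator A \<omega> - prob A) * g (V \<omega>))"
      using intA[OF gV] gV by (simp add: left_diff_distrib)
    fix \<theta>
    define c where "c = (CLINT \<omega>|M. iexp (\<theta> * V \<omega>))"
    have int: "integrable M (\<lambda>\<omega>. iexp (\<theta> * V \<omega>))" by (rule integrable_iexp_real) simp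
    have "(CLINT \<omega>:A|M. iexp (\<theta> * V \<omega>) - c) = 0"
    proof (rule set_integral_sigma_of_eq_zero[where X = X and J = J])
      show "integrable M (\<lambda>\<omega>. iexp (\<theta> * V \<omega>) - c)" using int by simp
      fix F B assume F: "finite F" "F \<subseteq> J" and B: "\<And>u. u \<in> F \<Longrightarrow> B u \<in> sets (borel :: real measure)"
      show "(CLINT \<omega>|M. (iexp (\<theta> * V \<omega>) - c) * of_real (\<Prod>u\<in>F. indicator (B u) (X u \<omega>))) = 0"
      proof (rule integral_eq_zero_of_multivariate_fourier_zero[OF F(1)])
        show "integrable M (\<lambda>\<omega>. iexp (\<theta> * V \<omega>) - c)" using int by simp
        show "(CLINT \<omega>|M. (iexp (\<theta> * V \<omega>) - c) * iexp (\<Sum>u\<in>F. \<tau> u * X u \<omega>)) = 0" for \<tau>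
          unfolding c_def
        proof (rule iexp_orthogonal[OF J closed_span_scale[OF V] _ F])
          show "L2_inner M (D u) (\<lambda>\<omega>. \<theta> * V \<omega>) = 0" if "u \<in> J" for u
            using orth[OF that] D_L2[of u] J that VL by (auto simp: L2.ip_bilinear)
        qed
      qed (use XJ F B in auto)
    qed (use XJ A in auto)
    also have "(CLINT \<omega>:A|M. iexp (\<theta> * V \<omega>) - c) =
        (CLINT \<omega>|M. indicat_real A \<omega> *\<^sub>R iexp (\<theta> * V \<omega>) - indicat_real A \<omega> *\<^sub>R c)"
      unfolding set_lebesgue_integral_def by (simp add: scaleR_diff_right)
    also have "\<dots> = (CLINT \<omega>|M. indicat_real A \<omega> *\<^sub>R iexp (\<theta> * V \<omega>)) - (CLINT \<omega>|M. indicat_real A \<omega> *\<^sub>R c)"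
      using int by (intro Bochner_Integration.integral_diff integrable_mult_indicator) auto
    also have "(CLINT \<omega>|M. indicat_real A \<omega> *\<^sub>R c) = prob A *\<^sub>R c"
      by (simp add: emeasure_eq_measure)
    finally have "(CLINT \<omega>|M. indicat_real A \<omega> *\<^sub>R iexp (\<theta> * V \<omega>)) = prob A *\<^sub>R c" by simp
    moreover have "(CLINT \<omega>|M. of_real (indicator A \<omega> - prob A) * iexp (\<theta> * V \<omega>))
      = (CLINT \<omega>|M. indicat_real A \<omega> *\<^sub>R iexp (\<theta> * V \<omega>) - prob A *\<^sub>R iexp (\<theta> * V \<omega>))"
      by (intro Bochner_Integration.integral_cong) (auto simp: scaleR_conv_of_real left_diff_distrib)
    moreover have "\<dots> = (CLINT \<omega>|M. indicat_real A \<omega> *\<^sub>R iexp (\<theta> * V \<omega>)) - (CLINT \<omega>|M. prob A *\<^sub>R iexp (\<theta> * V \<omega>))"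
      using int by (intro Bochner_Integration.integral_diff integrable_mult_indicator integrable_scaleR_right) auto
    moreover have "(CLINT \<omega>|M. prob A *\<^sub>R iexp (\<theta> * V \<omega>)) = prob A *\<^sub>R c"
      unfolding c_def by (rule integral_scaleR_right)
    ultimately show "(CLINT \<omega>|M. of_real (indicator A \<omega> - prob A) * iexp (\<theta> * V \<omega>)) = 0"
      by (simp only: diff_self)
  qed auto
  then show ?thesis using intA[OF gV] gV by (simp add: left_diff_distrib)
qed

end

section \<open>Conditional expectations in Gaussian spaces\<close>

lemma (in finite_measure_subalgebra) L1_real_cond_exp_le:
  assumes h: "integrable M h"
  shows "(\<integral>x. \<bar>real_cond_exp M F h x\<bar> \<partial>M) \<le> (\<integral>x. \<bar>h x\<bar> \<partial>M)"
proof -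
  have abs: "integrable M (\<lambda>x. \<bar>h x\<bar>)" "integrable M (\<lambda>x. - \<bar>h x\<bar>)" using h by auto
  have "AE x in M. real_cond_exp M F h x \<le> real_cond_exp M F (\<lambda>x. \<bar>h x\<bar>) x"
    by (rule real_cond_exp_mono) (use h abs in auto)
  moreover have "AE x in M. real_cond_exp M F (\<lambda>x. - \<bar>h x\<bar>) x \<le> real_cond_exp M F h x"
    by (rule real_cond_exp_mono) (use h abs in auto)
  moreover have "AE x in M. real_cond_exp M F (\<lambda>x. - 1 * \<bar>h x\<bar>) x = - 1 * real_cond_exp M F (\<lambda>x. \<bar>h x\<bar>) x"
    by (rule real_cond_exp_cmult[OF abs(1)])
  ultimately have "AE x in M. \<bar>real_cond_exp M F h x\<bar> \<le> real_cond_exp M F (\<lambda>x. \<bar>h x\<bar>) x"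
    by eventually_elim auto
  then have "(\<integral>x. \<bar>real_cond_exp M F h x\<bar> \<partial>M) \<le> (\<integral>x. real_cond_exp M F (\<lambda>x. \<bar>h x\<bar>) x \<partial>M)"
    by (intro integral_mono_AE integrable_abs real_cond_exp_int(1) h abs)
  also have "\<dots> = (\<integral>x. \<bar>h x\<bar> \<partial>M)" by (rule real_cond_exp_int(2)[OF abs(1)])
  finally show ?thesis .
qed

context gaussian_family
begin

lemma X_measurable: "u \<in> I \<Longrightarrow> X u \<in> borel_measurable M"
  using X_L2 L2_measurable by blast

lemma sigma_of_subalgebra: "J \<subseteq> I \<Longrightarrow> finite_measure_subalgebra M (sigma_of M X J)"
  unfolding finite_measure_subalgebra_def finite_measure_subalgebra_axioms_def
  using finite_measure_axioms subalgebra_sigma_of[of J X M] X_measurable by blast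

text \<open>An element of the closed span over \<open>J\<close> is only a limit of variables measurable with respect to \<open>X\<^sub>J\<close>,
  and need not itself be measurable with respect to that sigma-algebra, which is not completed by null
  sets. It agrees almost surely with its conditional expectation because conditioning contracts
  the \<open>L\<^sup>1\<close>-norm.\<close>
lemma cond_expect_closed_span:
  assumes J: "J \<subseteq> I" and V: "V \<in> closed_span J"
  shows "AE \<omega> in M. cond_expect M X J V \<omega> = V \<omega>"
proof -
  interpret S: finite_measure_subalgebra M "sigma_of M X J" using J by (rule sigma_of_subalgebra)
  let ?E = "real_cond_exp M (sigma_of M X J)"
  obtain w where w: "\<And>n. w n \<in> lin_span D J" "(\<lambda>n::nat. L2.nrm (\<lambda>x. w n x - V x)) \<longlonglongrightarrow> 0"
    using V unfolding L2.clos_def by blast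
  have VL: "V \<in> L2 M" using V by (rule closed_span_L2)
  have wL: "w n \<in> L2 M" for n using w(1) lin_span_D_L2[OF J] by blast
  have V_int: "integrable M V" using VL by (rule L2_integrable)
  have w_int: "integrable M (w n)" for n using wL by (rule L2_integrable)
  have w_meas: "w n \<in> borel_measurable (sigma_of M X J)" for n
  proof -
    obtain F c where F: "F \<subseteq> J" "w n = (\<lambda>x. \<Sum>u\<in>F. c u * D u x)"
      using lin_spanE[OF w(1)] by metis
    have "D u \<in> borel_measurable (sigma_of M X J)" if "u \<in> F" for u
      unfolding D_def using measurable_sigma_of[of u J X M] that F(1) by auto
    then show ?thesis unfolding F(2) by (intro borel_measurable_sum borel_measurable_times) auto
  qed
  have bound: "(\<integral>\<omega>. \<bar>?E V \<omega> - V \<omega>\<bar> \<partial>M) \<le> 2 * L2.nrm (\<lambda>x. w n x - V x)" for n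
  proof -
    have d: "(\<lambda>x. w n x - V x) \<in> L2 M" using wL VL by simp
    then have d_int: "integrable M (\<lambda>x. w n x - V x)" by (rule L2_integrable)
    have "AE \<omega> in M. ?E (\<lambda>x. w n x - V x) \<omega> = ?E (w n) \<omega> - ?E V \<omega>"
      using w_int V_int by (rule S.real_cond_exp_diff)
    moreover have "AE \<omega> in M. ?E (w n) \<omega> = w n \<omega>"
      using w_int w_meas by (rule S.real_cond_exp_F_meas)
    ultimately have "AE \<omega> in M. \<bar>?E V \<omega> - V \<omega>\<bar> \<le> \<bar>?E (\<lambda>x. w n x - V x) \<omega>\<bar> + \<bar>w n \<omega> - V \<omega>\<bar>"
      by eventually_elim auto
    then have "(\<integral>\<omega>. \<bar>?E V \<omega> - V \<omega>\<bar> \<partial>M) \<le> (\<integral>\<omega>. \<bar>?E (\<lambda>x. w n x - V x) \<omega>\<bar> + \<bar>w n \<omega> - V \<omega>\<bar> \<partial>M)"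
      by (intro integral_mono_AE integrable_abs Bochner_Integration.integrable_add
          Bochner_Integration.integrable_diff S.real_cond_exp_int(1) V_int w_int d_int)
    also have "\<dots> = (\<integral>\<omega>. \<bar>?E (\<lambda>x. w n x - V x) \<omega>\<bar> \<partial>M) + (\<integral>\<omega>. \<bar>w n \<omega> - V \<omega>\<bar> \<partial>M)"
      by (intro Bochner_Integration.integral_add integrable_abs S.real_cond_exp_int(1) d_int)
    also have "\<dots> \<le> 2 * (\<integral>\<omega>. \<bar>w n \<omega> - V \<omega>\<bar> \<partial>M)"
      using S.L1_real_cond_exp_le[OF d_int] by simp
    also have "\<dots> \<le> 2 * L2.nrm (\<lambda>x. w n x - V x)"
      using L1_le_L2[OF d] by (simp add: L2.nrm_def)
    finally show ?thesis .
  qed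
  have "(\<integral>\<omega>. \<bar>?E V \<omega> - V \<omega>\<bar> \<partial>M) \<le> 0"
  proof (rule LIMSEQ_le_const)
    show "(\<lambda>n. 2 * L2.nrm (\<lambda>x. w n x - V x)) \<longlonglongrightarrow> 0"
      using tendsto_mult_right_zero[OF w(2)] .
  qed (use bound in auto)
  then have "(\<integral>\<omega>. \<bar>?E V \<omega> - V \<omega>\<bar> \<partial>M) = 0"
    by (intro antisym) auto
  moreover have "integrable M (\<lambda>\<omega>. \<bar>?E V \<omega> - V \<omega>\<bar>)"
    by (intro integrable_abs Bochner_Integration.integrable_diff S.real_cond_exp_int(1) V_int)
  ultimately have "AE \<omega> in M. \<bar>?E V \<omega> - V \<omega>\<bar> = 0"
    using integral_nonneg_eq_0_iff_AE[of M "\<lambda>\<omega>. \<bar>?E V \<omega> - V \<omega>\<bar>"] by simp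
  then show ?thesis unfolding cond_expect_def by eventually_elim simp
qed

text \<open>The residual \<open>R\<close> is independent of \<open>X\<^sub>J\<close> and centred, so it contributes nothing to the conditional
  expectation. The version \<open>?E P\<close> of \<open>P\<close> is used as the candidate since it is measurable with respect
  to \<open>X\<^sub>J\<close>.\<close>
lemma cond_expect_eq_projection:
  assumes J: "J \<subseteq> I" and s: "s \<in> I" and P: "P \<in> closed_span J"
    and orth: "\<And>u. u \<in> J \<Longrightarrow> L2_inner M (D u) (\<lambda>x. D s x - P x) = 0"
  shows "AE \<omega> in M. cond_expect M X J (X s) \<omega> = expectation (X s) + P \<omega>"
proof -
  interpret S: finite_measure_subalgebra M "sigma_of M X J" using J by (rule sigma_of_subalgebra)
  let ?E = "real_cond_exp M (sigma_of M X J)"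
  define R where "R \<omega> = D s \<omega> - P \<omega>" for \<omega>
  define m where "m = expectation (X s)"
  have PI: "P \<in> closed_span I" using P closed_span_mono[OF J] by blast
  have R: "R \<in> closed_span I"
    unfolding R_def using D_closed_span[OF s order_refl] PI by (rule closed_span_diff)
  have int: "integrable M (X s)" "integrable M P" "integrable M R"
    using L2_integrable X_L2[OF s] closed_span_L2[OF P] closed_span_L2[OF R] by auto
  have [measurable]: "P \<in> borel_measurable M" "R \<in> borel_measurable M" using int by auto
  have X_eq: "X s \<omega> = m + P \<omega> + R \<omega>" for \<omega> by (simp add: R_def D_def m_def)
  have EP: "AE \<omega> in M. ?E P \<omega> = P \<omega>"
    using cond_expect_closed_span[OF J P] by (simp add: cond_expect_def)
  have "AE \<omega> in M. ?E (X s) \<omega> = m + ?E P \<omega>"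
  proof (rule S.real_cond_exp_charact)
    show "integrable M (X s)" by fact
    show "integrable M (\<lambda>\<omega>. m + ?E P \<omega>)" using S.real_cond_exp_int(1)[OF int(2)] by simp
    show "(\<lambda>\<omega>. m + ?E P \<omega>) \<in> borel_measurable (sigma_of M X J)" by measurable
    fix A assume A: "A \<in> sets (sigma_of M X J)"
    then have [measurable]: "A \<in> sets M" using S.subalg unfolding subalgebra_def by blast
    have "(\<integral>\<omega>. indicator A \<omega> * R \<omega> \<partial>M) = prob A * expectation R"
      using orthogonal_imp_independent[OF J R orth[folded R_def] A, of "\<lambda>y. y"] int(3) by simp
    then have R0: "(\<integral>\<omega>. indicator A \<omega> * R \<omega> \<partial>M) = 0"
      using expectation_closed_span[OF R] by simp
    have intA: "integrable M (\<lambda>\<omega>. indicator A \<omega> * f \<omega>)" if "integrable M f" for f :: "'a \<Rightarrow> real"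
      using integrable_mult_indicator[OF _ that, of A] by simp
    have mP: "integrable M (\<lambda>\<omega>. m + P \<omega>)" using int(2) by simp
    have "(\<integral>\<omega>\<in>A. X s \<omega> \<partial>M) = (\<integral>\<omega>. indicator A \<omega> * (m + P \<omega>) + indicator A \<omega> * R \<omega> \<partial>M)"
      unfolding set_lebesgue_integral_def X_eq by (simp add: distrib_left)
    also have "\<dots> = (\<integral>\<omega>. indicator A \<omega> * (m + P \<omega>) \<partial>M)"
      using R0 by (subst Bochner_Integration.integral_add[OF intA[OF mP] intA[OF int(3)]]) simp
    also have "\<dots> = (\<integral>\<omega>\<in>A. m + ?E P \<omega> \<partial>M)"
      unfolding set_lebesgue_integral_def
      by (intro integral_cong_AE) (use EP in \<open>auto simp: borel_measurable_cond_exp2\<close>)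
    finally show "(\<integral>\<omega>\<in>A. X s \<omega> \<partial>M) = (\<integral>\<omega>\<in>A. m + ?E P \<omega> \<partial>M)" .
  qed
  then show ?thesis using EP unfolding cond_expect_def m_def by eventually_elim simp
qed

text \<open>Independence of single elements of the Gaussian space suffices: by polarization \<open>R R'\<close> is a
  combination of the squares of \<open>R\<close>, \<open>R'\<close> and \<open>R + R'\<close>, each of which is independent of \<open>X\<^sub>J\<close>.\<close>
lemma cond_expect_residual_product:
  assumes J: "J \<subseteq> I" and R: "R \<in> closed_span I" and R': "R' \<in> closed_span I"
    and orth: "\<And>u. u \<in> J \<Longrightarrow> L2_inner M (D u) R = 0" "\<And>u. u \<in> J \<Longrightarrow> L2_inner M (D u) R' = 0"
  shows "AE \<omega> in M. cond_expect M X J (\<lambda>\<omega>. R \<omega> * R' \<omega>) \<omega> = L2_inner M R R'"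
proof -
  interpret S: finite_measure_subalgebra M "sigma_of M X J" using J by (rule sigma_of_subalgebra)
  have L: "R \<in> L2 M" "R' \<in> L2 M" using R R' closed_span_L2 by auto
  have int: "integrable M (\<lambda>\<omega>. R \<omega> * R' \<omega>)" using L by (rule L2_mult_integrable)
  show ?thesis unfolding cond_expect_def
  proof (rule S.real_cond_exp_charact)
    fix A assume A: "A \<in> sets (sigma_of M X J)"
    then have [measurable]: "A \<in> sets M" using S.subalg unfolding subalgebra_def by blast
    have sq: "(\<integral>\<omega>. indicator A \<omega> * (V \<omega>)\<^sup>2 \<partial>M) = prob A * (\<integral>\<omega>. (V \<omega>)\<^sup>2 \<partial>M)"
      and sq_int: "integrable M (\<lambda>\<omega>. (V \<omega>)\<^sup>2)" "integrable M (\<lambda>\<omega>. indicator A \<omega> * (V \<omega>)\<^sup>2)"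
      if V: "V \<in> closed_span I" "\<And>u. u \<in> J \<Longrightarrow> L2_inner M (D u) V = 0" for V
    proof -
      show i: "integrable M (\<lambda>\<omega>. (V \<omega>)\<^sup>2)" using closed_span_L2[OF V(1)] by (rule L2_square_integrable)
      show "integrable M (\<lambda>\<omega>. indicator A \<omega> * (V \<omega>)\<^sup>2)"
        using integrable_mult_indicator[OF _ i, of A] by simp
      show "(\<integral>\<omega>. indicator A \<omega> * (V \<omega>)\<^sup>2 \<partial>M) = prob A * (\<integral>\<omega>. (V \<omega>)\<^sup>2 \<partial>M)"
        by (rule orthogonal_imp_independent[OF J V A, of "\<lambda>y. y\<^sup>2"]) (use i in auto)
    qed
    define T where "T \<omega> = R \<omega> + R' \<omega>" for \<omega>
    have T: "T \<in> closed_span I" unfolding T_def using R R' by (rule closed_span_add)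
    have T_orth: "L2_inner M (D u) T = 0" if "u \<in> J" for u
      unfolding T_def using orth[OF that] D_L2[of u] L that J by (auto simp: L2.ip_bilinear)
    note sqs = sq[OF R orth(1)] sq[OF R' orth(2)] sq[OF T T_orth]
    note ints = sq_int[OF R orth(1)] sq_int[OF R' orth(2)] sq_int[OF T T_orth]
    have pol: "R \<omega> * R' \<omega> = ((T \<omega>)\<^sup>2 - (R \<omega>)\<^sup>2 - (R' \<omega>)\<^sup>2) / 2" for \<omega>
      by (simp add: T_def power2_sum)
    have "(\<integral>\<omega>\<in>A. R \<omega> * R' \<omega> \<partial>M) =
        (\<integral>\<omega>. (indicator A \<omega> * (T \<omega>)\<^sup>2 - indicator A \<omega> * (R \<omega>)\<^sup>2 - indicator A \<omega> * (R' \<omega>)\<^sup>2) / 2 \<partial>M)"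
      unfolding set_lebesgue_integral_def pol by (simp add: right_diff_distrib diff_divide_distrib)
    also have "\<dots> = prob A * (((\<integral>\<omega>. (T \<omega>)\<^sup>2 \<partial>M) - (\<integral>\<omega>. (R \<omega>)\<^sup>2 \<partial>M) - (\<integral>\<omega>. (R' \<omega>)\<^sup>2 \<partial>M)) / 2)"
      using ints by (simp add: sqs right_diff_distrib diff_divide_distrib)
    also have "((\<integral>\<omega>. (T \<omega>)\<^sup>2 \<partial>M) - (\<integral>\<omega>. (R \<omega>)\<^sup>2 \<partial>M) - (\<integral>\<omega>. (R' \<omega>)\<^sup>2 \<partial>M)) / 2 = L2_inner M R R'"
      unfolding L2_inner_def pol using ints by simp
    also have "prob A * L2_inner M R R' = (\<integral>\<omega>\<in>A. L2_inner M R R' \<partial>M)"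
      unfolding set_lebesgue_integral_def by (simp add: emeasure_eq_measure)
    finally show "(\<integral>\<omega>\<in>A. R \<omega> * R' \<omega> \<partial>M) = (\<integral>\<omega>\<in>A. L2_inner M R R' \<partial>M)" .
  qed (use int in auto)
qed

text \<open>Both conditions are equivalent to \<open>\<langle>R, R'\<rangle> = 0\<close> for the residuals \<open>R\<close>, \<open>R'\<close> of \<open>D s\<close>, \<open>D t\<close> after
  projection onto the closed span over \<open>J\<close>.\<close>
lemma conditionally_uncorrelated_iff:
  assumes J: "J \<subseteq> I" and s: "s \<in> I" and t: "t \<in> I"
    and K: "\<And>u v. u \<in> I \<Longrightarrow> v \<in> I \<Longrightarrow> K u v = L2_inner M (D u) (D v)"
  shows "(AE \<omega> in M. cond_expect M X J
      (\<lambda>\<omega>'. (X s \<omega>' - cond_expect M X J (X s) \<omega>') * (X t \<omega>' - cond_expect M X J (X t) \<omega>')) \<omega> = 0)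
    \<longleftrightarrow> K s t = rkhs_inner K J (\<lambda>u. K s u) (\<lambda>u. K u t)"
proof -
  interpret S: finite_measure_subalgebra M "sigma_of M X J" using J by (rule sigma_of_subalgebra)
  have DJ: "D u \<in> L2 M" if "u \<in> J" for u using D_L2 that J by blast
  obtain P where P: "P \<in> closed_span J" "\<And>u. u \<in> J \<Longrightarrow> L2_inner M (D u) (\<lambda>x. D s x - P x) = 0"
    using L2.span_projection[of J D "D s"] DJ D_L2[OF s] by blast
  obtain Q where Q: "Q \<in> closed_span J" "\<And>u. u \<in> J \<Longrightarrow> L2_inner M (D u) (\<lambda>x. D t x - Q x) = 0"
    using L2.span_projection[of J D "D t"] DJ D_L2[OF t] by blast
  define R where "R \<omega> = D s \<omega> - P \<omega>" for \<omega>
  define R' where "R' \<omega> = D t \<omega> - Q \<omega>" for \<omega>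
  have PL: "P \<in> L2 M" and QL: "Q \<in> L2 M" using P Q closed_span_L2 by auto
  note DL = D_L2[OF s] D_L2[OF t]
  have RL: "R \<in> L2 M" "R' \<in> L2 M" unfolding R_def R'_def using DL PL QL by auto
  have RI: "R \<in> closed_span I" "R' \<in> closed_span I"
    unfolding R_def R'_def using closed_span_mono[OF J] P(1) Q(1)
    by (auto intro!: closed_span_diff D_closed_span s t)
  have P_R': "L2_inner M P R' = 0"
    using L2.closed_span_orthogonal[OF DJ RL(2) Q(2)[folded R'_def] P(1)] .
  have Q_R: "L2_inner M Q R = 0"
    using L2.closed_span_orthogonal[OF DJ RL(1) P(2)[folded R_def] Q(1)] .
  have "L2_inner M R R' = L2_inner M (D s) (D t) - L2_inner M P Q"
    using P_R' Q_R DL PL QL unfolding R_def R'_def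
    by (simp add: L2.ip_bilinear L2.ip_commute[of Q P] L2.ip_commute[of Q "D s"])
  moreover have "rkhs_inner K J (\<lambda>u. K s u) (\<lambda>u. K u t) = L2_inner M P Q"
  proof (rule L2.rkhs_inner_feature_map[of J D])
    fix u assume u: "u \<in> J"
    then have uI: "u \<in> I" using J by blast
    show "K s u = L2_inner M (D u) P"
      using P(2)[OF u] K[OF s uI] DL PL DJ[OF u] by (simp add: L2.ip_bilinear L2.ip_commute[of "D s" "D u"])
    show "K u t = L2_inner M (D u) Q"
      using Q(2)[OF u] K[OF uI t] DL QL DJ[OF u] by (simp add: L2.ip_bilinear)
  qed (use DJ K J P(1) Q(1) in auto)
  ultimately have residual: "L2_inner M R R' = K s t - rkhs_inner K J (\<lambda>u. K s u) (\<lambda>u. K u t)"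
    using K[OF s t] by simp
  have [measurable]: "X s \<in> borel_measurable M" "X t \<in> borel_measurable M"
    "R \<in> borel_measurable M" "R' \<in> borel_measurable M"
    using X_measurable s t RL L2_measurable by auto
  have ae: "AE \<omega> in M. (X s \<omega> - cond_expect M X J (X s) \<omega>) * (X t \<omega> - cond_expect M X J (X t) \<omega>) = R \<omega> * R' \<omega>"
  proof -
    have "AE \<omega> in M. cond_expect M X J (X s) \<omega> = expectation (X s) + P \<omega>"
      by (rule cond_expect_eq_projection[OF J s P(1)]) (rule P(2))
    moreover have "AE \<omega> in M. cond_expect M X J (X t) \<omega> = expectation (X t) + Q \<omega>"
      by (rule cond_expect_eq_projection[OF J t Q(1)]) (rule Q(2))
    ultimately show ?thesis by eventually_elim (simp add: R_def R'_def D_def diff_diff_eq)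
  qed
  have "AE \<omega> in M. cond_expect M X J
      (\<lambda>\<omega>'. (X s \<omega>' - cond_expect M X J (X s) \<omega>') * (X t \<omega>' - cond_expect M X J (X t) \<omega>')) \<omega>
      = cond_expect M X J (\<lambda>\<omega>. R \<omega> * R' \<omega>) \<omega>"
    unfolding cond_expect_def
    by (rule S.real_cond_exp_cong) (use ae in \<open>auto simp: cond_expect_def borel_measurable_cond_exp2\<close>)
  moreover have "AE \<omega> in M. cond_expect M X J (\<lambda>\<omega>. R \<omega> * R' \<omega>) \<omega> = L2_inner M R R'"
    by (rule cond_expect_residual_product[OF J RI P(2)[folded R_def] Q(2)[folded R'_def]])
  ultimately have "AE \<omega> in M. cond_expect M X J
      (\<lambda>\<omega>'. (X s \<omega>' - cond_expect M X J (X s) \<omega>') * (X t \<omega>' - cond_expect M X J (X t) \<omega>')) \<omega>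
      = L2_inner M R R'" (is "AE \<omega> in M. ?C \<omega> = _")
    by eventually_elim simp
  then have "(AE \<omega> in M. ?C \<omega> = 0) \<longleftrightarrow> (AE \<omega> in M. L2_inner M R R' = 0)"
    by (intro iffI; elim AE_mp) (auto elim: eventually_mono)
  also have "\<dots> \<longleftrightarrow> L2_inner M R R' = 0" by simp
  finally show ?thesis unfolding residual by simp
qed

text \<open>The quadratic form of \<open>K\<close> is the squared norm of the corresponding combination of the \<open>D u\<close>.\<close>
lemma covariance_mem:
  assumes K: "\<And>u v. u \<in> I \<Longrightarrow> v \<in> I \<Longrightarrow> K u v = L2_inner M (D u) (D v)"
  shows "K \<in> covariances I"
  unfolding covariances_def
proof (intro CollectI conjI ballI allI impI)
  show "K s t = K t s" if "s \<in> I" "t \<in> I" for s t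
    using that D_L2 L2.ip_commute by (simp add: K)
  fix n :: nat and t \<alpha> :: "nat \<Rightarrow> real"
  assume "\<forall>i\<in>{1..n}. t i \<in> I"
  then have t: "t i \<in> I" if "i \<in> {1..n}" for i using that by blast
  define Y where "Y = (\<lambda>x. \<Sum>i\<in>{1..n}. \<alpha> i * D (t i) x)"
  have DL: "D (t i) \<in> L2 M" if "i \<in> {1..n}" for i using t[OF that] by (rule D_L2)
  have Y: "Y \<in> L2 M" and ip_Y: "g \<in> L2 M \<Longrightarrow> L2_inner M Y g = (\<Sum>i\<in>{1..n}. \<alpha> i * L2_inner M (D (t i)) g)" for g
    using L2.sum_mem_ip_sum_left[of "{1..n}" "\<lambda>i. D (t i)" \<alpha>] DL unfolding Y_def by auto
  have "0 \<le> L2_inner M Y Y" using Y by (rule L2.ip_nonneg)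
  also have "L2_inner M Y Y = (\<Sum>i=1..n. \<alpha> i * (\<Sum>j=1..n. \<alpha> j * L2_inner M (D (t j)) (D (t i))))"
    unfolding ip_Y[OF Y]
    by (intro sum.cong refl) (simp add: L2.ip_commute[OF DL Y] ip_Y[OF DL])
  also have "\<dots> = (\<Sum>i=1..n. \<Sum>j=1..n. \<alpha> i * \<alpha> j * K (t i) (t j))"
    unfolding sum_distrib_left
    by (intro sum.cong refl) (simp add: K t L2.ip_commute[OF DL DL] mult.assoc)
  finally show "(\<Sum>i=1..n. \<Sum>j=1..n. \<alpha> i * \<alpha> j * K (t i) (t j)) \<ge> 0" .
qed

end

theorem theorem4p3:
  fixes M :: "'a measure"
    and I :: "real set"
    and \<Omega> :: "(real \<times> real) set"
    and X :: "real \<Rightarrow> 'a \<Rightarrow> real"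
    and K :: "real \<Rightarrow> real \<Rightarrow> real"
  assumes "prob_space M"
    and "is_interval I"
    and "serrated_domain I \<Omega>"
    and "gaussian_process M I X"
    and "has_covariance M I X K"
  shows "undirected_graphical_model M I X \<Omega> \<longleftrightarrow> K \<in> graphical_covariances I \<Omega>"
proof -
  interpret gaussian_family M I X
    using assms(1,4) by (intro gaussian_family.intro gaussian_family_axioms.intro)
  have K: "K u v = L2_inner M (D u) (D v)" if "u \<in> I" "v \<in> I" for u v
    using assms(5) that by (simp add: has_covariance_def L2_inner_def D_def)
  show ?thesis
    unfolding undirected_graphical_model_def graphical_covariances_def
    using conditionally_uncorrelated_iff[OF _ _ _ K] covariance_mem[OF K] by blast
qed

end
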